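(* For every $k\geq 1$ and $n=3k+1$, the cubic form $$F_n=\sum_{i=0}^{k}x_{3i}x_{3i+1}^2+\sum_{i=1}^{k}x_{3i-2}x_{3i-1}x_{3i+1}\in\mathbb C[x_0,\dots,x_n]$$ is wild.
   Context: Let $V^*=\langle x_0,\dots,x_n\rangle$ over $\mathbb C$ and $F\in S^dV^*$ a nonzero form (here $d=3$). Let $X=\nu_d(\mathbb P^n)\subset\mathbb P(S^dV^* )$ be the Veronese variety of $d$-th powers $[L^d]$, $L\in V^*$. The border rank $\underline{\mathbf r}(F)$ is the least $r$ with $[F]\in\sigma_r(X)$, the $r$-th secant variety of $X$ (closure of the union of spans of $r$ points of $X$). The smoothable rank $\mathrm{sr}(F)$ is the least $r$ such that there is a zero-dimensional scheme $R\subset X$ of length $r$, smoothable in $X$ (a flat limit of reduced schemes of $r$ distinct points of $X$), with $[F]$ in the linear span of $R$. $F$ is wild if $\mathrm{sr}(F)>\underline{\mathbf r}(F)$. *)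

theory Defs
  imports
    Complex_Main
    "HOL-Library.Poly_Mapping"
    "HOL-Library.Extended_Nat"
    "HOL-Computational_Algebra.Formal_Power_Series"
begin

text \<open>
  Polynomials with coefficients in 'c and variables indexed by 'i.  Two index types are used:
  natural numbers, for the variables of the forms in \<open>S\<^sup>d V\<^sup>*\<close>, and monomials,
  for the homogeneous coordinates on \<open>P(S\<^sup>d V\<^sup>*)\<close>.
\<close>

type_synonym ('i, 'c) polyn = "('i \<Rightarrow>\<^sub>0 nat) \<Rightarrow>\<^sub>0 'c"

definition Var :: "'i \<Rightarrow> ('i, 'c::comm_ring_1) polyn" where
  "Var i = Poly_Mapping.single (Poly_Mapping.single i 1) 1"

definition smult :: "'c::comm_ring_1 \<Rightarrow> ('i, 'c) polyn \<Rightarrow> ('i, 'c) polyn" where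
  "smult c p = Poly_Mapping.single 0 c * p"

global_interpretation cvec: vector_space "smult :: complex \<Rightarrow> ('i, complex) polyn \<Rightarrow> _"
  by unfold_locales
    (simp_all add: smult_def algebra_simps single_add mult_single flip: mult.assoc)

definition mdeg :: "('i \<Rightarrow>\<^sub>0 nat) \<Rightarrow> nat" where
  "mdeg m = (\<Sum>i\<in>Poly_Mapping.keys m. Poly_Mapping.lookup m i)"

definition eval_at :: "('i \<Rightarrow> 'c) \<Rightarrow> ('i, 'c::comm_ring_1) polyn \<Rightarrow> 'c" where
  "eval_at v p = (\<Sum>m\<in>Poly_Mapping.keys p. Poly_Mapping.lookup p m *
     (\<Prod>i\<in>Poly_Mapping.keys m. v i ^ Poly_Mapping.lookup m i))"

definition poly_ring :: "'i set \<Rightarrow> ('i, 'c::comm_ring_1) polyn set" where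
  "poly_ring A = {p. \<forall>m\<in>Poly_Mapping.keys p. Poly_Mapping.keys m \<subseteq> A}"

definition homogeneous :: "nat \<Rightarrow> ('i, 'c::comm_ring_1) polyn \<Rightarrow> bool" where
  "homogeneous k p \<longleftrightarrow> (\<forall>m\<in>Poly_Mapping.keys p. mdeg m = k)"

definition hom_comp :: "nat \<Rightarrow> ('i, 'c::comm_ring_1) polyn \<Rightarrow> ('i, 'c) polyn" where
  "hom_comp k p = (\<Sum>m\<in>{m \<in> Poly_Mapping.keys p. mdeg m = k}.
     Poly_Mapping.single m (Poly_Mapping.lookup p m))"

definition forms :: "'i set \<Rightarrow> nat \<Rightarrow> ('i, 'c::comm_ring_1) polyn set" where
  "forms A k = {p \<in> poly_ring A. homogeneous k p}"


section \<open>Closed subschemes of projective space\<close>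

text \<open>
  For a finite index set A, closed subschemes of the projective space with homogeneous
  coordinates indexed by A correspond bijectively to the saturated homogeneous ideals of
  \<^term>\<open>poly_ring A\<close>.  Any homogeneous ideal defines a subscheme, and two homogeneous ideals
  define the same one iff they agree in all sufficiently large degrees.
\<close>

definition homogeneous_ideal :: "'i set \<Rightarrow> ('i, 'c::comm_ring_1) polyn set \<Rightarrow> bool" where
  "homogeneous_ideal A I \<longleftrightarrow>
     I \<subseteq> poly_ring A \<and> 0 \<in> I \<and>
     (\<forall>p\<in>I. \<forall>q\<in>I. p + q \<in> I) \<and>
     (\<forall>p\<in>I. \<forall>s\<in>poly_ring A. s * p \<in> I) \<and>
     (\<forall>p\<in>I. \<forall>k. hom_comp k p \<in> I)"

definition saturated :: "'i set \<Rightarrow> ('i, 'c::comm_ring_1) polyn set \<Rightarrow> bool" where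
  "saturated A I \<longleftrightarrow>
     (\<forall>p\<in>poly_ring A.
        (\<exists>N. \<forall>m. Poly_Mapping.keys m \<subseteq> A \<and> mdeg m = N \<longrightarrow> Poly_Mapping.single m 1 * p \<in> I)
        \<longrightarrow> p \<in> I)"

definition same_subscheme ::
    "('i, 'c::comm_ring_1) polyn set \<Rightarrow> ('i, 'c) polyn set \<Rightarrow> bool" where
  "same_subscheme I J \<longleftrightarrow>
     (\<exists>k0. \<forall>k\<ge>k0. \<forall>p. homogeneous k p \<longrightarrow> (p \<in> I \<longleftrightarrow> p \<in> J))"

definition hilbert_function :: "'i set \<Rightarrow> ('i, complex) polyn set \<Rightarrow> nat \<Rightarrow> nat" where
  "hilbert_function A I k = cvec.dim (forms A k :: ('i, complex) polyn set)
     - cvec.dim (I \<inter> forms A k)"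

text \<open>Dimension zero and length r means that the Hilbert polynomial is the constant r.\<close>

definition zero_dim_scheme :: "'i set \<Rightarrow> nat \<Rightarrow> ('i, complex) polyn set \<Rightarrow> bool" where
  "zero_dim_scheme A r I \<longleftrightarrow> homogeneous_ideal A I \<and> saturated A I \<and>
     (\<exists>k0. \<forall>k\<ge>k0. hilbert_function A I k = r)"

text \<open>
  The homogeneous ideal of a set of points, given by representing coordinate vectors.  Testing
  homogeneous components makes it independent of the choice of representatives.
\<close>

definition proj_ideal :: "'i set \<Rightarrow> ('i \<Rightarrow> 'c) set \<Rightarrow> ('i, 'c::comm_ring_1) polyn set" where
  "proj_ideal A U = {p \<in> poly_ring A. \<forall>k. \<forall>v\<in>U. eval_at v (hom_comp k p) = 0}"

definition zariski_closure :: "'i set \<Rightarrow> ('i \<Rightarrow> complex) set \<Rightarrow> ('i \<Rightarrow> complex) set" where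
  "zariski_closure A U = {v. \<forall>p\<in>proj_ideal A U. eval_at v p = 0}"


section \<open>Flat limits of distinct points\<close>

text \<open>
  One-parameter families are taken over the discrete valuation ring \<open>C[[t]]\<close>: a closed
  subscheme of projective space over this ring is given by a homogeneous ideal J with
  coefficients in \<^typ>\<open>complex fps\<close>, and over a discrete valuation ring flatness
  means absence of t-torsion in the quotient by J.
\<close>

definition flat_family :: "'i set \<Rightarrow> ('i, complex fps) polyn set \<Rightarrow> bool" where
  "flat_family A J \<longleftrightarrow> homogeneous_ideal A J \<and>
     (\<forall>p\<in>poly_ring A. smult fps_X p \<in> J \<longrightarrow> p \<in> J)"

text \<open>The ideal generated by J over \<open>C((t))\<close>, contracted to \<open>C[[t]]\<close>-coefficients.\<close>

definition generic_fibre ::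
    "'i set \<Rightarrow> ('i, complex fps) polyn set \<Rightarrow> ('i, complex fps) polyn set" where
  "generic_fibre A J = {p \<in> poly_ring A. \<exists>N. smult (fps_X ^ N) p \<in> J}"

definition special_fibre :: "('i, complex fps) polyn set \<Rightarrow> ('i, complex) polyn set" where
  "special_fibre J = Poly_Mapping.map (\<lambda>c. fps_nth c 0) ` J"

text \<open>
  A \<open>C((t))\<close>-point of projective space is represented by a nonzero coordinate vector with
  entries in \<open>C[[t]]\<close> (clear denominators).  It lies on the projective variety with
  homogeneous ideal IX iff it satisfies the equations in IX.
\<close>

definition fps_point_on ::
    "'i set \<Rightarrow> ('i, complex) polyn set \<Rightarrow> ('i \<Rightarrow> complex fps) \<Rightarrow> bool" where
  "fps_point_on A IX q \<longleftrightarrow> (\<exists>i\<in>A. q i \<noteq> 0) \<and>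
     (\<forall>p\<in>IX. eval_at q (Poly_Mapping.map fps_const p) = 0)"

definition proj_distinct :: "'i set \<Rightarrow> ('i \<Rightarrow> 'c::comm_ring_1) \<Rightarrow> ('i \<Rightarrow> 'c) \<Rightarrow> bool" where
  "proj_distinct A v w \<longleftrightarrow> (\<exists>i\<in>A. \<exists>j\<in>A. v i * w j \<noteq> v j * w i)"

text \<open>
  The subscheme defined by I is the special fibre of a flat family over \<open>C[[t]]\<close> whose generic
  fibre is the reduced scheme of r distinct points of the variety X with ideal IX.  Taking the
  points rational over \<open>C((t))\<close> is no restriction: they become rational after a base change
  \<open>t = s\<^sup>e\<close>, which does not affect the special fibre.
\<close>

definition smoothable_in ::
    "'i set \<Rightarrow> ('i, complex) polyn set \<Rightarrow> nat \<Rightarrow> ('i, complex) polyn set \<Rightarrow> bool" where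
  "smoothable_in A IX r I \<longleftrightarrow>
     (\<exists>J q. flat_family A J \<and>
        (\<forall>a<r. fps_point_on A IX (q a)) \<and>
        (\<forall>a<r. \<forall>b<r. a \<noteq> b \<longrightarrow> proj_distinct A (q a) (q b)) \<and>
        same_subscheme (generic_fibre A J) (proj_ideal A (q ` {..<r})) \<and>
        same_subscheme (special_fibre J) I)"


section \<open>Ranks with respect to the Veronese variety\<close>

text \<open>
  Here \<open>V\<^sup>*\<close> has basis \<open>x\<^sub>0, \<dots>, x\<^sub>n\<close>.  A form is a point of the affine space
  \<open>S\<^sup>d V\<^sup>*\<close>; its coordinates are its coefficients, indexed by the monomials of degree d.
\<close>

abbreviation Sd :: "nat \<Rightarrow> nat \<Rightarrow> (nat, complex) polyn set" where
  "Sd n d \<equiv> forms {..n} d"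

definition monomials :: "nat \<Rightarrow> nat \<Rightarrow> (nat \<Rightarrow>\<^sub>0 nat) set" where
  "monomials n d = {m. Poly_Mapping.keys m \<subseteq> {..n} \<and> mdeg m = d}"

text \<open>All nonzero vectors over the points \<open>[L\<^sup>d]\<close> (scalars have d-th roots, for d positive).\<close>

definition veronese :: "nat \<Rightarrow> nat \<Rightarrow> (nat, complex) polyn set" where
  "veronese n d = {L ^ d | L. L \<in> Sd n 1 \<and> L \<noteq> 0}"

definition veronese_ideal :: "nat \<Rightarrow> nat \<Rightarrow> (nat \<Rightarrow>\<^sub>0 nat, complex) polyn set" where
  "veronese_ideal n d = proj_ideal (monomials n d) (Poly_Mapping.lookup ` veronese n d)"

text \<open>The affine cone over the r-th secant variety; the r points are allowed to coincide.\<close>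

definition secant_variety :: "nat \<Rightarrow> nat \<Rightarrow> nat \<Rightarrow> (nat, complex) polyn set" where
  "secant_variety r n d = {F \<in> Sd n d. Poly_Mapping.lookup F \<in>
     zariski_closure (monomials n d)
       (Poly_Mapping.lookup ` (\<Union>P\<in>{P. \<forall>a<r. P a \<in> veronese n d}. cvec.span (P ` {..<r})))}"

definition linear_span ::
    "nat \<Rightarrow> nat \<Rightarrow> (nat \<Rightarrow>\<^sub>0 nat, complex) polyn set \<Rightarrow> (nat, complex) polyn set" where
  "linear_span n d I = {F \<in> Sd n d.
     \<forall>l \<in> I \<inter> forms (monomials n d) 1. eval_at (Poly_Mapping.lookup F) l = 0}"

text \<open>Minima are taken in \<^typ>\<open>enat\<close>; both are finite for every nonzero form.\<close>

definition border_rank :: "nat \<Rightarrow> nat \<Rightarrow> (nat, complex) polyn \<Rightarrow> enat" where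
  "border_rank n d F = (INF r\<in>{r. F \<in> secant_variety r n d}. enat r)"

definition smoothable_rank :: "nat \<Rightarrow> nat \<Rightarrow> (nat, complex) polyn \<Rightarrow> enat" where
  "smoothable_rank n d F =
     (INF r\<in>{r. \<exists>R. zero_dim_scheme (monomials n d) r R \<and>
                veronese_ideal n d \<subseteq> R \<and>
                smoothable_in (monomials n d) (veronese_ideal n d) r R \<and>
                F \<in> linear_span n d R}. enat r)"

definition wild :: "nat \<Rightarrow> nat \<Rightarrow> (nat, complex) polyn \<Rightarrow> bool" where
  "wild n d F \<longleftrightarrow> F \<in> Sd n d \<and> F \<noteq> 0 \<and> smoothable_rank n d F > border_rank n d F"

end

theory Submission
  imports Defs
begin

text \<open>
  Border rank at most \<open>n + 1\<close>: write \<open>y\<^sub>i = x\<^sub>3\<^sub>i\<^sub>+\<^sub>1\<close>.  On each line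
  \<open>\<langle>y\<^sub>i\<^sub>-\<^sub>1, y\<^sub>i\<rangle>\<close> take three further points whose cubes satisfy a relation with the
  cubes of the two ends; the relations telescope along the chain to one relation between the cubes
  of \<open>3k + 2 = n + 1\<close> linear forms, and the cubic is a first-order deformation of it.

  Smoothable rank at least \<open>n + 2\<close>, which already holds without smoothability: suppose that a
  zero-dimensional scheme with ideal R and length at most \<open>n + 1\<close> has F in its linear span.  Choose
  \<open>l \<in> V\<close> with \<open>l\<^sup>3\<close> a nonzerodivisor modulo R.  As F is concise, \<open>b \<mapsto> l\<^sup>2 b\<close> is
  injective into the degree 1 part of the quotient by R, and by dimension surjective.  So
  \<open>l v w \<equiv> l\<^sup>2 b\<close>, that is \<open>v w \<equiv> l b\<close>, for suitable b, and a vector a in the kernel of the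
  Hessian of F at \<open>l\<close> satisfies \<open>F(a v w) = F(a l b) = 0\<close> for all v and w.  Hence \<open>a = 0\<close>,
  although the Hessian determinant of F vanishes identically.
\<close>

section \<open>Evaluation and graded pieces\<close>

definition mev :: "('i \<Rightarrow> 'c) \<Rightarrow> ('i \<Rightarrow>\<^sub>0 nat) \<Rightarrow> 'c::comm_ring_1" where
  "mev v m = (\<Prod>i\<in>Poly_Mapping.keys m. v i ^ Poly_Mapping.lookup m i)"

lemma mev_superset:
  assumes "finite K" "Poly_Mapping.keys m \<subseteq> K"
  shows "mev v m = (\<Prod>i\<in>K. v i ^ Poly_Mapping.lookup m i)"
  unfolding mev_def
  by (rule prod.mono_neutral_left) (use assms in \<open>auto simp: in_keys_iff\<close>)

lemma mev_zero [simp]: "mev v 0 = 1"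
  by (simp add: mev_def)

lemma mev_single [simp]: "mev v (Poly_Mapping.single i e) = v i ^ e"
  by (cases "e = 0") (simp_all add: mev_def)

lemma mev_add: "mev v (m + m') = mev v m * mev v m'"
proof -
  let ?K = "Poly_Mapping.keys m \<union> Poly_Mapping.keys m'"
  have K: "finite ?K" by simp
  have "mev v (m + m') = (\<Prod>i\<in>?K. v i ^ Poly_Mapping.lookup (m + m') i)"
    by (rule mev_superset[OF K keys_add])
  also have "\<dots> = mev v m * mev v m'"
    by (simp add: mev_superset[OF K, of m] mev_superset[OF K, of m'] lookup_add power_add
        prod.distrib)
  finally show ?thesis .
qed

lemma eval_at_superset:
  assumes "finite K" "Poly_Mapping.keys p \<subseteq> K"
  shows "eval_at v p = (\<Sum>m\<in>K. Poly_Mapping.lookup p m * mev v m)"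
  unfolding eval_at_def mev_def[symmetric]
  by (rule sum.mono_neutral_left) (use assms in \<open>auto simp: in_keys_iff\<close>)

lemma eval_at_zero [simp]: "eval_at v 0 = 0"
  by (simp add: eval_at_def)

lemma eval_at_add [simp]: "eval_at v (p + q) = eval_at v p + eval_at v q"
proof -
  let ?K = "Poly_Mapping.keys p \<union> Poly_Mapping.keys q"
  have K: "finite ?K" by simp
  show ?thesis
    by (simp add: eval_at_superset[OF K keys_add] eval_at_superset[OF K, of p]
        eval_at_superset[OF K, of q] lookup_add distrib_right sum.distrib)
qed

lemma eval_at_single [simp]: "eval_at v (Poly_Mapping.single m c) = c * mev v m"
  by (cases "c = 0") (simp_all add: eval_at_def mev_def)

lemma eval_at_sum [simp]: "eval_at v (sum f I) = (\<Sum>i\<in>I. eval_at v (f i))"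
  by (induction I rule: infinite_finite_induct) simp_all

lemma poly_mapping_sum_single:
  "p = (\<Sum>m\<in>Poly_Mapping.keys p. Poly_Mapping.single m (Poly_Mapping.lookup p m))"
  by (rule poly_mapping_eqI) (simp add: lookup_sum lookup_single when_def in_keys_iff)

lemma eval_at_mult [simp]: "eval_at v (p * q) = eval_at v p * eval_at v q"
proof -
  have "p * q = (\<Sum>m\<in>Poly_Mapping.keys p. \<Sum>m'\<in>Poly_Mapping.keys q.
      Poly_Mapping.single (m + m') (Poly_Mapping.lookup p m * Poly_Mapping.lookup q m'))"
    by (subst poly_mapping_sum_single[of p], subst poly_mapping_sum_single[of q])
       (simp only: sum_product mult_single)
  then show ?thesis
    by (simp only: eval_at_sum eval_at_single mev_add)
       (simp add: eval_at_def mev_def[symmetric] sum_product algebra_simps)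
qed

lemma eval_at_one [simp]: "eval_at v 1 = 1"
  by (simp flip: single_one)

lemma eval_at_power [simp]: "eval_at v (p ^ k) = eval_at v p ^ k"
  by (induction k) simp_all

lemma eval_at_uminus [simp]: "eval_at v (- p) = - eval_at v p"
  using eval_at_add[of v p "- p"] by (simp add: eq_neg_iff_add_eq_0 add.commute del: eval_at_add)

lemma eval_at_diff [simp]: "eval_at v (p - q) = eval_at v p - eval_at v q"
  using eval_at_add[of v p "- q"] by simp

lemma eval_at_smult [simp]: "eval_at v (smult c p) = c * eval_at v p"
  by (simp add: smult_def)

lemma eval_at_Var [simp]: "eval_at v (Var i) = v i"
  by (simp add: Var_def)

lemma lookup_smult [simp]: "Poly_Mapping.lookup (smult c p) m = c * Poly_Mapping.lookup p m"
proof -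
  have "smult c p = (\<Sum>m\<in>Poly_Mapping.keys p. Poly_Mapping.single m (c * Poly_Mapping.lookup p m))"
    unfolding smult_def
    by (subst poly_mapping_sum_single[of p]) (simp only: sum_distrib_left mult_single add_0_left)
  then show ?thesis
    by (simp add: lookup_sum lookup_single when_def in_keys_iff)
qed

lemma smult_mult_left: "smult c p * q = smult c (p * q)"
  by (simp add: smult_def mult.assoc)

lemma smult_mult_right: "p * smult c q = smult c (p * q)"
  by (simp add: smult_def mult.left_commute)

section \<open>Degrees, spaces of forms and homogeneous components\<close>

lemma mdeg_superset:
  assumes "finite K" "Poly_Mapping.keys m \<subseteq> K"
  shows "mdeg m = (\<Sum>i\<in>K. Poly_Mapping.lookup m i)"
  unfolding mdeg_def
  by (rule sum.mono_neutral_left) (use assms in \<open>auto simp: in_keys_iff\<close>)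

lemma mdeg_add: "mdeg (m + m') = mdeg m + mdeg m'"
proof -
  let ?K = "Poly_Mapping.keys m \<union> Poly_Mapping.keys m'"
  have K: "finite ?K" by simp
  show ?thesis
    by (simp add: mdeg_superset[OF K keys_add] mdeg_superset[OF K, of m]
        mdeg_superset[OF K, of m'] lookup_add sum.distrib)
qed

lemma mdeg_zero [simp]: "mdeg 0 = 0"
  by (simp add: mdeg_def)

lemma mdeg_single [simp]: "mdeg (Poly_Mapping.single i e) = e"
  by (cases "e = 0") (simp_all add: mdeg_def)

lemma finite_monomials_of_degree:
  assumes "finite A"
  shows "finite {m. Poly_Mapping.keys m \<subseteq> A \<and> mdeg m = d}" (is "finite ?M")
proof (rule finite_imageD[where f = Poly_Mapping.lookup])
  have "Poly_Mapping.lookup ` ?M \<subseteq> {f. \<forall>i. (i \<in> A \<longrightarrow> f i \<in> {..d}) \<and> (i \<notin> A \<longrightarrow> f i = 0)}"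
  proof clarify
    fix m :: "'a \<Rightarrow>\<^sub>0 nat" and i
    assume m: "Poly_Mapping.keys m \<subseteq> A"
    have "Poly_Mapping.lookup m i \<le> mdeg m" if "i \<in> A"
      using member_le_sum[of i A "Poly_Mapping.lookup m"] that assms
      by (simp add: mdeg_superset[OF assms m])
    moreover have "Poly_Mapping.lookup m i = 0" if "i \<notin> A"
      using m that by (auto simp: in_keys_iff)
    ultimately show "(i \<in> A \<longrightarrow> Poly_Mapping.lookup m i \<in> {..mdeg m}) \<and>
        (i \<notin> A \<longrightarrow> Poly_Mapping.lookup m i = 0)"
      by simp
  qed
  then show "finite (Poly_Mapping.lookup ` ?M)"
    by (rule finite_subset) (rule finite_set_of_finite_funs, use assms in simp_all)
  show "inj_on Poly_Mapping.lookup ?M"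
    by (simp add: inj_on_def lookup_inject)
qed

lemma finite_monomials: "finite (monomials n d)"
  unfolding monomials_def by (rule finite_monomials_of_degree) simp

lemma forms_iff:
  "p \<in> forms A d \<longleftrightarrow> (\<forall>m\<in>Poly_Mapping.keys p. Poly_Mapping.keys m \<subseteq> A \<and> mdeg m = d)"
  by (auto simp: forms_def poly_ring_def homogeneous_def)

lemma keys_forms_monomials: "p \<in> Sd n d \<Longrightarrow> Poly_Mapping.keys p \<subseteq> monomials n d"
  by (auto simp: forms_iff monomials_def)

lemma forms_poly_ring: "p \<in> forms A d \<Longrightarrow> p \<in> poly_ring A"
  by (simp add: forms_def)

lemma forms_zero [simp]: "0 \<in> forms A d"
  by (simp add: forms_iff)

lemma forms_add: "p \<in> forms A d \<Longrightarrow> q \<in> forms A d \<Longrightarrow> p + q \<in> forms A d"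
  using keys_add[of p q] by (auto simp: forms_iff)

lemma forms_mult: "p \<in> forms A d \<Longrightarrow> q \<in> forms A e \<Longrightarrow> p * q \<in> forms A (d + e)"
  unfolding forms_iff
proof
  fix m
  assume p: "\<forall>m\<in>Poly_Mapping.keys p. Poly_Mapping.keys m \<subseteq> A \<and> mdeg m = d"
    and q: "\<forall>m\<in>Poly_Mapping.keys q. Poly_Mapping.keys m \<subseteq> A \<and> mdeg m = e"
    and "m \<in> Poly_Mapping.keys (p * q)"
  then obtain a b where "m = a + b" "a \<in> Poly_Mapping.keys p" "b \<in> Poly_Mapping.keys q"
    using keys_mult[of p q] by blast
  moreover have "Poly_Mapping.keys a \<subseteq> A" "mdeg a = d" "Poly_Mapping.keys b \<subseteq> A" "mdeg b = e"
    using p q \<open>a \<in> _\<close> \<open>b \<in> _\<close> by blast+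
  ultimately show "Poly_Mapping.keys m \<subseteq> A \<and> mdeg m = d + e"
    using keys_add[of a b] by (simp add: mdeg_add) blast
qed

lemma forms_single:
  "Poly_Mapping.keys m \<subseteq> A \<Longrightarrow> mdeg m = d \<Longrightarrow> Poly_Mapping.single m c \<in> forms A d"
  by (auto simp: forms_iff split: if_splits)

lemma forms_smult: "p \<in> forms A d \<Longrightarrow> smult c p \<in> forms A d"
  using forms_mult[OF forms_single[of 0 A 0 c], of p d] by (simp add: smult_def)

lemma forms_Var: "i \<in> A \<Longrightarrow> Var i \<in> forms A 1"
  unfolding Var_def by (rule forms_single) auto

lemma forms_uminus: "p \<in> forms A d \<Longrightarrow> - p \<in> forms A d"
  by (simp add: forms_iff)

lemma forms_diff: "p \<in> forms A d \<Longrightarrow> q \<in> forms A d \<Longrightarrow> p - q \<in> forms A d"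
  using forms_add[OF _ forms_uminus, of p A d q] by simp

lemma forms_sum: "(\<And>i. i \<in> I \<Longrightarrow> f i \<in> forms A d) \<Longrightarrow> sum f I \<in> forms A d"
  by (induction I rule: infinite_finite_induct) (auto intro: forms_add)

lemma forms_power: "p \<in> forms A d \<Longrightarrow> p ^ k \<in> forms A (k * d)"
proof (induction k)
  case 0
  then show ?case using forms_single[of 0 A 0 1] by simp
next
  case (Suc k)
  then show ?case using forms_mult[of p A d "p ^ k"] by simp
qed

lemma lookup_hom_comp:
  "Poly_Mapping.lookup (hom_comp k p) m = (if mdeg m = k then Poly_Mapping.lookup p m else 0)"
  by (auto simp: hom_comp_def lookup_sum lookup_single when_def in_keys_iff)

lemma hom_comp_form: "p \<in> forms A d \<Longrightarrow> hom_comp k p = (if k = d then p else 0)"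
  by (intro poly_mapping_eqI) (auto simp: lookup_hom_comp forms_iff in_keys_iff)

lemma sum_hom_comp: "p = (\<Sum>k\<in>mdeg ` Poly_Mapping.keys p. hom_comp k p)"
proof (rule poly_mapping_eqI)
  fix m
  have "(\<Sum>k\<in>mdeg ` Poly_Mapping.keys p. Poly_Mapping.lookup (hom_comp k p) m)
    = (if mdeg m \<in> mdeg ` Poly_Mapping.keys p then Poly_Mapping.lookup p m else 0)"
    by (simp add: lookup_hom_comp)
  also have "\<dots> = Poly_Mapping.lookup p m"
    by (auto simp: in_keys_iff)
  finally show "Poly_Mapping.lookup p m
      = Poly_Mapping.lookup (\<Sum>k\<in>mdeg ` Poly_Mapping.keys p. hom_comp k p) m"
    by (simp add: lookup_sum)
qed

lemma proj_ideal_form_iff: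
  "p \<in> forms A d \<Longrightarrow> p \<in> proj_ideal A U \<longleftrightarrow> (\<forall>v\<in>U. eval_at v p = 0)"
  by (auto simp: proj_ideal_def forms_poly_ring hom_comp_form)

lemma proj_ideal_eval:
  assumes "p \<in> proj_ideal A U" "v \<in> U"
  shows "eval_at v p = 0"
proof -
  have "eval_at v p = (\<Sum>k\<in>mdeg ` Poly_Mapping.keys p. eval_at v (hom_comp k p))"
    by (simp only: eval_at_sum[symmetric] sum_hom_comp[symmetric])
  then show ?thesis using assms by (simp add: proj_ideal_def)
qed

section \<open>Dimension counting in a graded piece\<close>

lemma forms_subset_span:
  "forms A d \<subseteq> cvec.span ((\<lambda>m. Poly_Mapping.single m 1) ` {m. Poly_Mapping.keys m \<subseteq> A \<and> mdeg m = d})"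
proof
  fix p :: "('a, complex) polyn"
  assume p: "p \<in> forms A d"
  have "p = (\<Sum>m\<in>Poly_Mapping.keys p. smult (Poly_Mapping.lookup p m) (Poly_Mapping.single m 1))"
    using poly_mapping_sum_single[of p] by (simp add: smult_def mult_single)
  also have "\<dots> \<in> cvec.span ((\<lambda>m. Poly_Mapping.single m 1) ` {m. Poly_Mapping.keys m \<subseteq> A \<and> mdeg m = d})"
    using p by (intro cvec.span_sum cvec.span_scale cvec.span_base) (auto simp: forms_iff)
  finally show "p \<in> cvec.span ((\<lambda>m. Poly_Mapping.single m 1) ` {m. Poly_Mapping.keys m \<subseteq> A \<and> mdeg m = d})" .
qed

lemma span_image_sum:
  assumes "finite I" "x \<in> cvec.span (g ` I)"
  shows "\<exists>c. x = (\<Sum>i\<in>I. smult (c i) (g i))"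
proof -
  let ?T = "{x. \<exists>c. x = (\<Sum>i\<in>I. smult (c i) (g i))}"
  have "cvec.subspace ?T"
    unfolding cvec.subspace_def
  proof (intro conjI ballI allI)
    show "0 \<in> ?T" by (auto intro!: exI[of _ "\<lambda>_. 0"])
  next
    fix x y assume "x \<in> ?T" "y \<in> ?T"
    then obtain c d where "x = (\<Sum>i\<in>I. smult (c i) (g i))" "y = (\<Sum>i\<in>I. smult (d i) (g i))"
      by blast
    then have "x + y = (\<Sum>i\<in>I. smult (c i + d i) (g i))"
      by (simp add: cvec.scale_left_distrib sum.distrib)
    then show "x + y \<in> ?T" by (intro CollectI exI)
  next
    fix a x assume "x \<in> ?T"
    then obtain c where "x = (\<Sum>i\<in>I. smult (c i) (g i))" by blast
    then have "smult a x = (\<Sum>i\<in>I. smult (a * c i) (g i))"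
      by (simp add: cvec.scale_sum_right)
    then show "smult a x \<in> ?T" by (intro CollectI exI)
  qed
  moreover have "g ` I \<subseteq> ?T"
  proof clarify
    fix i assume "i \<in> I"
    then have "g i = (\<Sum>j\<in>I. smult ((\<lambda>j. if j = i then 1 else 0) j) (g j))"
      using assms(1) by (simp add: if_distribR if_distrib[of smult] cong: if_cong)
    then show "\<exists>c. g i = (\<Sum>j\<in>I. smult (c j) (g j))" by (rule exI[where P = "\<lambda>c. g i = (\<Sum>j\<in>I. smult (c j) (g j))"])
  qed
  ultimately show ?thesis
    using assms(2) cvec.span_minimal[of "g ` I" ?T] by blast
qed

text \<open>A basis of \<open>R \<inter> forms A d\<close> stays independent when the
  \<open>g i\<close> are adjoined, because they are independent modulo R; everything then fits into
  a basis of \<open>forms A d\<close>. Finiteness of A makes these spaces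
  finite-dimensional.\<close>

lemma codim_bound:
  fixes g :: "nat \<Rightarrow> ('i, complex) polyn"
  assumes A: "finite A" and R: "cvec.subspace R"
    and g: "\<And>i. i < s \<Longrightarrow> g i \<in> forms A d"
    and ind: "\<And>c. (\<Sum>i<s. smult (c i) (g i)) \<in> R \<Longrightarrow> \<forall>i<s. c i = 0"
  shows "s \<le> cvec.dim (forms A d :: ('i, complex) polyn set) - cvec.dim (R \<inter> forms A d)"
proof -
  let ?S = "forms A d :: ('i, complex) polyn set"
  let ?M = "(\<lambda>m. Poly_Mapping.single m 1 :: ('i, complex) polyn) ` {m. Poly_Mapping.keys m \<subseteq> A \<and> mdeg m = d}"
  have M: "finite ?M" using finite_monomials_of_degree[OF A] by blast
  obtain B where B: "B \<subseteq> R \<inter> ?S" "cvec.independent B" "R \<inter> ?S \<subseteq> cvec.span B"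
    "card B = cvec.dim (R \<inter> ?S)"
    using cvec.basis_exists by blast
  obtain C where C: "C \<subseteq> ?S" "cvec.independent C" "?S \<subseteq> cvec.span C" "card C = cvec.dim ?S"
    using cvec.basis_exists by blast
  have finC: "finite C"
    using cvec.independent_span_bound[OF M C(2)] C(1) forms_subset_span by blast
  have finB: "finite B"
    using cvec.independent_span_bound[OF M B(2)] B(1) forms_subset_span by blast
  have step: "cvec.independent (B \<union> g ` {..<i}) \<and> card (B \<union> g ` {..<i}) = card B + i" if "i \<le> s" for i
    using that
  proof (induction i)
    case 0
    then show ?case using B by simp
  next
    case (Suc i)
    have notin: "g i \<notin> cvec.span (B \<union> g ` {..<i})"
    proof
      assume "g i \<in> cvec.span (B \<union> g ` {..<i})"
      then obtain x y where xy: "g i = x + y" "x \<in> cvec.span B" "y \<in> cvec.span (g ` {..<i})"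
        by (auto simp: cvec.span_Un)
      have x: "x \<in> R"
        using xy(2) B(1) cvec.span_minimal[of B R] R by blast
      obtain c where c: "y = (\<Sum>j<i. smult (c j) (g j))"
        using span_image_sum[OF _ xy(3)] by blast
      \<comment> \<open>The relation for \<open>g i\<close> modulo R, written with coefficient 1 at
        i; \<open>ind\<close> would force this 1 to vanish.\<close>
      let ?c = "\<lambda>j. if j < i then - c j else if j = i then 1 else 0"
      have "(\<Sum>j<s. smult (?c j) (g j)) = (\<Sum>j<Suc i. smult (?c j) (g j))"
        using Suc.prems by (intro sum.mono_neutral_right) auto
      also have "\<dots> = g i - y"
        by (simp add: c sum_negf)
      finally have "(\<Sum>j<s. smult (?c j) (g j)) \<in> R"
        using x xy(1) by simp
      then have "\<forall>j<s. ?c j = 0" by (rule ind)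
      then show False using Suc.prems by (auto dest!: spec[of _ i])
    qed
    then have "g i \<notin> B \<union> g ` {..<i}"
      by (metis cvec.span_base)
    moreover have "B \<union> g ` {..<Suc i} = insert (g i) (B \<union> g ` {..<i})"
      by (simp add: lessThan_Suc)
    moreover have "cvec.independent (insert (g i) (B \<union> g ` {..<i}))"
      using cvec.independent_insertI[OF notin] Suc by simp
    ultimately show ?case
      using Suc finB by simp
  qed
  have "B \<union> g ` {..<s} \<subseteq> ?S" using B(1) g by auto
  then have "card (B \<union> g ` {..<s}) \<le> card C"
    using cvec.independent_span_bound[OF finC] step[of s] C(3) by blast
  then show ?thesis using step[of s] B(4) C(4) by simp
qed

section \<open>Zero-dimensional subschemes of the Veronese variety\<close>

definition dot :: "nat \<Rightarrow> (nat \<Rightarrow> complex) \<Rightarrow> (nat \<Rightarrow> complex) \<Rightarrow> complex" where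
  "dot n x u = (\<Sum>i\<le>n. x i * u i)"

definition lin :: "nat \<Rightarrow> (nat \<Rightarrow> complex) \<Rightarrow> (nat, complex) polyn" where
  "lin n x = (\<Sum>i\<le>n. smult (x i) (Var i))"

text \<open>The linear coordinate form on \<open>S\<^sup>3 V\<^sup>*\<close> that sends a cubic G to its value \<open>G(u)\<close>.\<close>

definition ev :: "nat \<Rightarrow> (nat \<Rightarrow> complex) \<Rightarrow> (nat \<Rightarrow>\<^sub>0 nat, complex) polyn" where
  "ev n u = (\<Sum>m\<in>monomials n 3. smult (mev u m) (Var m))"

lemma dot_add [simp]: "dot n x (\<lambda>i. u i + v i) = dot n x u + dot n x v"
  by (simp add: dot_def distrib_left sum.distrib)

lemma dot_scale: "dot n x (\<lambda>i. c * u i) = c * dot n x u"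
  by (simp add: dot_def sum_distrib_left mult.left_commute)

lemma lin_form: "lin n x \<in> Sd n 1"
  unfolding lin_def by (intro forms_sum forms_smult forms_Var) auto

lemma eval_at_lin [simp]: "eval_at u (lin n x) = dot n x u"
  by (simp add: lin_def dot_def)

lemma mdeg_eq_1E:
  assumes "mdeg m = 1"
  obtains i where "m = Poly_Mapping.single i 1"
proof -
  obtain i where i: "i \<in> Poly_Mapping.keys m" "Poly_Mapping.lookup m i = 1"
    "\<forall>j\<in>Poly_Mapping.keys m. i \<noteq> j \<longrightarrow> Poly_Mapping.lookup m j = 0"
    using assms sum_eq_1_iff[of "Poly_Mapping.keys m" "Poly_Mapping.lookup m"] unfolding mdeg_def by auto
  then have "m = Poly_Mapping.single i 1"
    by (intro poly_mapping_eqI) (auto simp: lookup_single when_def in_keys_iff)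
  then show ?thesis by (rule that)
qed

lemma linear_form_eq_lin:
  assumes "L \<in> Sd n 1"
  shows "L = lin n (\<lambda>i. Poly_Mapping.lookup L (Poly_Mapping.single i 1))"
proof (rule poly_mapping_eqI)
  fix m
  have *: "Poly_Mapping.lookup (lin n x) m = (\<Sum>i\<le>n. if Poly_Mapping.single i 1 = m then x i else 0)" for x
    by (simp add: lin_def lookup_sum Var_def lookup_single when_def if_distrib cong: if_cong)
  show "Poly_Mapping.lookup L m
      = Poly_Mapping.lookup (lin n (\<lambda>i. Poly_Mapping.lookup L (Poly_Mapping.single i 1))) m"
  proof (cases "\<exists>i\<le>n. m = Poly_Mapping.single i 1")
    case True
    then obtain i where i: "i \<le> n" "m = Poly_Mapping.single i 1" by blast
    have "Poly_Mapping.single j (1::nat) = m \<longleftrightarrow> j = i" for j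
      unfolding i by (metis lookup_single_eq lookup_single_not_eq one_neq_zero)
    then show ?thesis unfolding * using i by simp
  next
    case False
    have "m \<notin> Poly_Mapping.keys L"
    proof
      assume "m \<in> Poly_Mapping.keys L"
      then have m: "Poly_Mapping.keys m \<subseteq> {..n}" "mdeg m = 1"
        using assms by (auto simp: forms_iff)
      from m(2) obtain i where "m = Poly_Mapping.single i 1" by (rule mdeg_eq_1E)
      then show False using m(1) False by auto
    qed
    moreover have "(\<Sum>i\<le>n. if Poly_Mapping.single i 1 = m then x i else 0) = 0" for x :: "nat \<Rightarrow> complex"
      by (rule sum.neutral) (use False in auto)
    ultimately show ?thesis by (simp add: * in_keys_iff)
  qed
qed

lemma ev_form: "ev n u \<in> forms (monomials n 3) 1"
  unfolding ev_def by (intro forms_sum forms_smult forms_Var)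

lemma eval_at_ev:
  assumes "G \<in> Sd n 3"
  shows "eval_at (Poly_Mapping.lookup G) (ev n u) = eval_at u G"
  using eval_at_superset[OF finite_monomials keys_forms_monomials[OF assms], of u]
  by (simp add: ev_def mult.commute)

lemma eval_at_veronese_ev [simp]:
  "eval_at (Poly_Mapping.lookup (lin n x ^ 3)) (ev n u) = dot n x u * dot n x u * dot n x u"
proof -
  have "lin n x ^ 3 \<in> Sd n 3"
    using forms_power[OF lin_form, of n x 3] by simp
  from eval_at_ev[OF this] show ?thesis by (simp add: power3_eq_cube)
qed

section \<open>Vandermonde argument and a curve that separates cubic monomials\<close>

text \<open>Induction on D, replacing the polynomial with vector coefficients \<open>v e\<close> by
  its divided difference at one node: this has lower degree and the same leading coefficient, which
  therefore lies in R and can be subtracted.\<close>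

lemma vandermonde_mem:
  fixes c :: "nat \<Rightarrow> complex"
  assumes R: "cvec.subspace R" and c: "inj c"
  shows "card J > D \<Longrightarrow> (\<And>j. j \<in> J \<Longrightarrow> (\<Sum>e\<le>D. smult (c j ^ e) (v e)) \<in> R) \<Longrightarrow> e \<le> D \<Longrightarrow> v e \<in> R"
proof (induction D arbitrary: J v e)
  case 0
  then have "J \<noteq> {}" by auto
  then obtain j where "j \<in> J" by blast
  with 0 show ?case by fastforce
next
  case (Suc D)
  from Suc.prems(1) have fin: "finite J" by (metis card.infinite not_less_zero)
  from Suc.prems(1) have "J \<noteq> {}" by auto
  then obtain a where a: "a \<in> J" by blast
  let ?p = "\<lambda>j. \<Sum>e\<le>Suc D. smult (c j ^ e) (v e)"
  \<comment> \<open>Coefficients of the quotient by \<open>x - c a\<close> of the polynomial minus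
    its value at \<open>c a\<close>; the top one \<open>w D\<close> equals
    \<open>v (Suc D)\<close>.\<close>
  define w where "w i = (\<Sum>e = Suc i..Suc D. smult (c a ^ (e - Suc i)) (v e))" for i
  have diff: "?p j - ?p a = smult (c j - c a) (\<Sum>i\<le>D. smult (c j ^ i) (w i))" for j
  proof -
    have "?p j - ?p a = (\<Sum>e\<le>Suc D. smult (c j ^ e - c a ^ e) (v e))"
      by (simp only: sum_subtractf cvec.scale_left_diff_distrib)
    also have "\<dots> = (\<Sum>e\<le>Suc D. \<Sum>i<e. smult ((c j - c a) * (c a ^ (e - Suc i) * c j ^ i)) (v e))"
      by (simp only: power_diff_sumr2 cvec.scale_sum_left[symmetric] sum_distrib_left)
    also have "\<dots> = (\<Sum>i<Suc D. \<Sum>e = Suc i..Suc D. smult ((c j - c a) * (c a ^ (e - Suc i) * c j ^ i)) (v e))"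
      by (rule sum.nested_swap')
    also have "\<dots> = smult (c j - c a) (\<Sum>i\<le>D. smult (c j ^ i) (w i))"
      by (simp only: w_def cvec.scale_sum_right cvec.scale_scale lessThan_Suc_atMost mult.assoc mult.commute)
    finally show ?thesis .
  qed
  have q: "(\<Sum>i\<le>D. smult (c j ^ i) (w i)) \<in> R" if j: "j \<in> J - {a}" for j
  proof -
    have "c j - c a \<noteq> 0" using j injD[OF c] by auto
    moreover have "smult (c j - c a) (\<Sum>i\<le>D. smult (c j ^ i) (w i)) \<in> R"
      unfolding diff[symmetric]
      by (rule cvec.subspace_diff[OF R]) (use Suc.prems(2) j a in auto)
    ultimately show ?thesis
      using cvec.subspace_scale[OF R, of _ "inverse (c j - c a)"] by fastforce
  qed
  have "w D \<in> R"
    by (rule Suc.IH[of "J - {a}"]) (use q Suc.prems(1) fin a in auto)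
  then have top: "v (Suc D) \<in> R" by (simp add: w_def)
  have low: "(\<Sum>e\<le>D. smult (c j ^ e) (v e)) \<in> R" if "j \<in> J" for j
    using cvec.subspace_diff[OF R Suc.prems(2)[OF that] cvec.subspace_scale[OF R top, of "c j ^ Suc D"]]
    by simp
  show ?case
  proof (cases "e = Suc D")
    case True
    then show ?thesis using top by simp
  next
    case False
    then show ?thesis using Suc.IH[of J v e] Suc.prems low by auto
  qed
qed

text \<open>The lowest digit is the residue modulo 4; the others follow by induction after division
  by 4.\<close>

lemma base_4_unique:
  fixes a b :: "nat \<Rightarrow> nat"
  shows "(\<And>i. a i < 4) \<Longrightarrow> (\<And>i. b i < 4) \<Longrightarrow> (\<Sum>i\<le>n. 4 ^ i * a i) = (\<Sum>i\<le>n. 4 ^ i * b i)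
    \<Longrightarrow> i \<le> n \<Longrightarrow> a i = b i"
proof (induction n arbitrary: a b i)
  case 0
  then show ?case by simp
next
  case (Suc n)
  have *: "(\<Sum>i\<le>Suc n. 4 ^ i * f i) = f 0 + 4 * (\<Sum>i\<le>n. 4 ^ i * f (Suc i))" for f :: "nat \<Rightarrow> nat"
    by (subst sum.atMost_Suc_shift) (simp add: sum_distrib_left mult.assoc)
  have eq: "a 0 + 4 * (\<Sum>i\<le>n. 4 ^ i * a (Suc i)) = b 0 + 4 * (\<Sum>i\<le>n. 4 ^ i * b (Suc i))"
    using Suc.prems(3) unfolding * .
  moreover have "a 0 < 4" "b 0 < 4" using Suc.prems by auto
  ultimately have "a 0 = b 0" and "(\<Sum>i\<le>n. 4 ^ i * a (Suc i)) = (\<Sum>i\<le>n. 4 ^ i * b (Suc i))"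
    by presburger+
  then show ?case
    using Suc.IH[of "\<lambda>i. a (Suc i)" "\<lambda>i. b (Suc i)" "i - 1"] Suc.prems by (cases i) auto
qed

text \<open>
  Along this curve the monomials of degree 3 take pairwise different powers of the parameter as
  values, because base 4 digits are unique.
\<close>

definition curve :: "nat \<Rightarrow> nat \<Rightarrow> complex" where
  "curve j i = of_nat (Suc j) ^ 4 ^ i"

definition wt :: "nat \<Rightarrow> (nat \<Rightarrow>\<^sub>0 nat) \<Rightarrow> nat" where
  "wt n m = (\<Sum>i\<le>n. 4 ^ i * Poly_Mapping.lookup m i)"

text \<open>The parameter \<open>Suc j\<close> in place of j keeps all coordinates nonzero, as the
  Hessian argument will require of l.\<close>

lemma curve_nonzero: "curve j i \<noteq> 0"
  by (simp add: curve_def del: of_nat_Suc)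

lemma mev_curve:
  assumes "m \<in> monomials n d"
  shows "mev (curve j) m = of_nat (Suc j) ^ wt n m"
proof -
  have "Poly_Mapping.keys m \<subseteq> {..n}" using assms by (simp add: monomials_def)
  from mev_superset[OF _ this, of "curve j"] show ?thesis
    by (simp add: curve_def wt_def power_sum power_mult del: of_nat_Suc)
qed

text \<open>Exponents in a cubic monomial are at most 3, so they are the base 4 digits of the
  weight.\<close>

lemma inj_on_wt: "inj_on (wt n) (monomials n 3)"
proof (rule inj_onI)
  fix m m' assume m: "m \<in> monomials n 3" and m': "m' \<in> monomials n 3" and eq: "wt n m = wt n m'"
  have bound: "Poly_Mapping.lookup p i < 4" if "p \<in> monomials n 3" for p i
  proof (cases "i \<in> Poly_Mapping.keys p")
    case True
    then have "Poly_Mapping.lookup p i \<le> mdeg p"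
      unfolding mdeg_def by (intro member_le_sum) auto
    then show ?thesis using that by (simp add: monomials_def)
  qed (simp add: in_keys_iff)
  show "m = m'"
  proof (rule poly_mapping_eqI)
    fix i
    show "Poly_Mapping.lookup m i = Poly_Mapping.lookup m' i"
    proof (cases "i \<le> n")
      case True
      show ?thesis
        by (rule base_4_unique[OF bound[OF m] bound[OF m'] eq[unfolded wt_def] True])
    next
      case False
      then have "i \<notin> Poly_Mapping.keys m" "i \<notin> Poly_Mapping.keys m'"
        using m m' by (auto simp: monomials_def)
      then show ?thesis by (simp add: in_keys_iff)
    qed
  qed
qed

section \<open>Arithmetic modulo the ideal of a zero-dimensional scheme\<close>

locale veronese_subscheme =
  fixes n r :: nat and R :: "(nat \<Rightarrow>\<^sub>0 nat, complex) polyn set"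
  assumes zero_dim: "zero_dim_scheme (monomials n 3) r R"
    and veronese: "veronese_ideal n 3 \<subseteq> R"
begin

abbreviation A :: "(nat \<Rightarrow>\<^sub>0 nat) set" where
  "A \<equiv> monomials n 3"

abbreviation lam :: "nat \<Rightarrow> (nat \<Rightarrow>\<^sub>0 nat, complex) polyn" where
  "lam j \<equiv> ev n (curve j)"

lemma R_mult: "s \<in> forms A d \<Longrightarrow> p \<in> R \<Longrightarrow> s * p \<in> R"
  using zero_dim forms_poly_ring[of s A d]
  unfolding zero_dim_scheme_def homogeneous_ideal_def by blast

lemma R_subspace: "cvec.subspace R"
  unfolding cvec.subspace_def
proof (intro conjI ballI allI)
  show "0 \<in> R"
    using zero_dim unfolding zero_dim_scheme_def homogeneous_ideal_def by blast
  show "x + y \<in> R" if "x \<in> R" "y \<in> R" for x y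
    using that zero_dim unfolding zero_dim_scheme_def homogeneous_ideal_def by blast
  show "smult c x \<in> R" if "x \<in> R" for c x
    unfolding smult_def by (rule R_mult[OF forms_single that]) auto
qed

lemmas R_add = cvec.subspace_add[OF R_subspace]
lemmas R_diff = cvec.subspace_diff[OF R_subspace]
lemmas R_smult = cvec.subspace_scale[OF R_subspace]
lemmas R_sum = cvec.subspace_sum[OF R_subspace]

text \<open>Contrapositive of saturation for one chosen degree e. It serves to lift several
  nonmembers of R to a common degree.\<close>

lemma R_saturated:
  assumes "p \<in> forms A d" "p \<notin> R"
  shows "\<exists>q\<in>forms A e. q * p \<notin> R"
proof (rule ccontr)
  assume "\<not> ?thesis"
  then have "\<forall>m. Poly_Mapping.keys m \<subseteq> A \<and> mdeg m = e \<longrightarrow> Poly_Mapping.single m 1 * p \<in> R"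
    by (auto intro: forms_single)
  then have "p \<in> R"
    using zero_dim forms_poly_ring[OF assms(1)] unfolding zero_dim_scheme_def saturated_def by blast
  then show False using assms by blast
qed

lemma codim_le:
  "\<exists>k0. \<forall>K\<ge>k0. \<forall>s g. (\<forall>i<s. g i \<in> forms A K) \<longrightarrow>
     (\<forall>c. (\<Sum>i<s. smult (c i) (g i)) \<in> R \<longrightarrow> (\<forall>i<s. c i = 0)) \<longrightarrow> s \<le> r"
proof -
  obtain k0 where k0: "\<And>K. K \<ge> k0 \<Longrightarrow> hilbert_function A R K = r"
    using zero_dim unfolding zero_dim_scheme_def by blast
  show ?thesis
  proof (intro exI allI impI)
    fix K s :: nat and g :: "nat \<Rightarrow> (nat \<Rightarrow>\<^sub>0 nat, complex) polyn"
    assume "K \<ge> k0" "\<forall>i<s. g i \<in> forms A K"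
      "\<forall>c. (\<Sum>i<s. smult (c i) (g i)) \<in> R \<longrightarrow> (\<forall>i<s. c i = 0)"
    then show "s \<le> r"
      using codim_bound[OF finite_monomials R_subspace, of s g n 3 K] k0[of K]
      unfolding hilbert_function_def by simp
  qed
qed

text \<open>The difference of two forms with equal values at all cubes lies in the ideal of the
  Veronese variety, hence in R. Congruences modulo R are thus reduced to identities between values
  at \<open>lin n x ^ 3\<close>.\<close>

lemma R_cong:
  assumes s: "s \<in> forms A d" and s': "s' \<in> forms A d"
    and eq: "\<And>x. eval_at (Poly_Mapping.lookup (lin n x ^ 3)) s
                = eval_at (Poly_Mapping.lookup (lin n x ^ 3)) s'"
  shows "s \<in> R \<longleftrightarrow> s' \<in> R"
proof -
  have "eval_at (Poly_Mapping.lookup (L ^ 3)) (s - s') = 0" if "L \<in> Sd n 1" for L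
    using eq[of "\<lambda>i. Poly_Mapping.lookup L (Poly_Mapping.single i 1)"] linear_form_eq_lin[OF that] by simp
  then have "s - s' \<in> veronese_ideal n 3"
    unfolding veronese_ideal_def proj_ideal_form_iff[OF forms_diff[OF s s']]
    by (auto simp: veronese_def)
  then have "s - s' \<in> R" using veronese by blast
  then show ?thesis
    using R_add[of "s - s'" s'] R_diff[of s "s - s'"] by auto
qed

text \<open>\<open>lam j * f\<close> is a polynomial in \<open>Suc j\<close> whose coefficients are
  the products \<open>Var m * f\<close>, since the weights are distinct. More values in R than its
  degree put every \<open>Var m * f\<close> into R, and saturation gives f.\<close>

lemma lam_mult_bound:
  assumes f: "f \<in> forms A d" and J: "card J > (\<Sum>m\<in>A. wt n m)"
    and mem: "\<And>j. j \<in> J \<Longrightarrow> lam j * f \<in> R"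
  shows "f \<in> R"
proof -
  define D where "D = (\<Sum>m\<in>A. wt n m)"
  define v where "v e = (\<Sum>m\<in>{m\<in>A. wt n m = e}. Var m * f)" for e
  have D: "wt n m \<le> D" if "m \<in> A" for m
    unfolding D_def by (rule member_le_sum) (use that finite_monomials in auto)
  have "lam j * f = (\<Sum>e\<le>D. smult (of_nat (Suc j) ^ e) (v e))" for j
  proof -
    have "lam j * f = (\<Sum>m\<in>A. smult (of_nat (Suc j) ^ wt n m) (Var m * f))"
      by (simp add: ev_def sum_distrib_right smult_mult_left mev_curve del: of_nat_Suc)
    also have "\<dots> = (\<Sum>e\<le>D. \<Sum>m\<in>{m\<in>A. wt n m = e}. smult (of_nat (Suc j) ^ wt n m) (Var m * f))"
      by (rule sum.group[symmetric]) (use finite_monomials D in auto)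
    also have "\<dots> = (\<Sum>e\<le>D. smult (of_nat (Suc j) ^ e) (v e))"
      by (simp add: v_def cvec.scale_sum_right del: of_nat_Suc)
    finally show ?thesis .
  qed
  then have "v e \<in> R" if "e \<le> D" for e
    using vandermonde_mem[OF R_subspace, of "\<lambda>j. of_nat (Suc j)" D J v e] J mem that
    by (auto simp: D_def inj_def simp del: of_nat_Suc)
  moreover have "v (wt n m) = Var m * f" if "m \<in> A" for m
  proof -
    have "{m'\<in>A. wt n m' = wt n m} = {m}"
      using that inj_onD[OF inj_on_wt] by auto
    then show ?thesis by (simp add: v_def)
  qed
  ultimately have Var: "Var m * f \<in> R" if "m \<in> A" for m
    using D that by metis
  show ?thesis
  proof (rule ccontr)
    assume "f \<notin> R"
    then have "\<not> (\<forall>\<mu>. Poly_Mapping.keys \<mu> \<subseteq> A \<and> mdeg \<mu> = 1 \<longrightarrow> Poly_Mapping.single \<mu> 1 * f \<in> R)"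
      using zero_dim forms_poly_ring[OF f] unfolding zero_dim_scheme_def saturated_def by blast
    then obtain \<mu> where \<mu>: "Poly_Mapping.keys \<mu> \<subseteq> A" "mdeg \<mu> = 1" "Poly_Mapping.single \<mu> 1 * f \<notin> R"
      by blast
    from \<mu>(2) obtain m where "\<mu> = Poly_Mapping.single m 1" by (rule mdeg_eq_1E)
    then show False using \<mu> Var[of m] by (auto simp: Var_def)
  qed
qed

section \<open>A nonzerodivisor modulo R among the \<open>lam j\<close>\<close>

definition Z :: "(nat \<Rightarrow>\<^sub>0 nat, complex) polyn \<Rightarrow> nat set" where
  "Z f = {j. lam j * f \<in> R}"

text \<open>The bound depends neither on f nor on its degree, so that a maximal \<open>Z f\<close>
  exists.\<close>

lemma Z_bound:
  assumes f: "f \<in> forms A d" "f \<notin> R"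
  shows "finite (Z f)" "card (Z f) \<le> (\<Sum>m\<in>A. wt n m)"
proof -
  have *: "card J \<le> (\<Sum>m\<in>A. wt n m)" if "J \<subseteq> Z f" for J
    using lam_mult_bound[OF f(1), of J] f(2) that unfolding Z_def by force
  show "card (Z f) \<le> (\<Sum>m\<in>A. wt n m)" by (rule *) simp
  show "finite (Z f)"
  proof (rule ccontr)
    assume "infinite (Z f)"
    then obtain J where "J \<subseteq> Z f" "card J = Suc (\<Sum>m\<in>A. wt n m)"
      using infinite_arbitrarily_large by blast
    then show False using *[of J] by simp
  qed
qed

text \<open>
  Maximality of \<open>Z f\<close> replaces primality of the annihilator of f modulo R: multiplying by
  \<open>lam i\<close> for i outside of \<open>Z f\<close> cannot lead into R, since it cannot enlarge \<open>Z\<close>.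
\<close>

definition extremal :: "nat \<Rightarrow> (nat \<Rightarrow>\<^sub>0 nat, complex) polyn \<Rightarrow> bool" where
  "extremal j f \<longleftrightarrow> (\<exists>d. f \<in> forms A d) \<and> f \<notin> R \<and> j \<in> Z f \<and>
     (\<forall>d. \<forall>f'\<in>forms A d. f' \<notin> R \<longrightarrow> j \<in> Z f' \<longrightarrow> card (Z f') \<le> card (Z f))"

lemma extremal_exists:
  assumes "f \<in> forms A d" "f \<notin> R" "lam j * f \<in> R"
  shows "\<exists>f. extremal j f"
proof -
  let ?P = "\<lambda>f. (\<exists>d. f \<in> forms A d) \<and> f \<notin> R \<and> j \<in> Z f"
  have "\<exists>f. ?P f \<and> (\<forall>f'. ?P f' \<longrightarrow> card (Z f') \<le> card (Z f))"
  proof (rule ex_has_greatest_nat)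
    show "?P f" using assms by (auto simp: Z_def)
    show "\<forall>f. ?P f \<longrightarrow> card (Z f) < Suc (\<Sum>m\<in>A. wt n m)"
      using Z_bound(2) by (auto simp: less_Suc_eq_le)
  qed
  then show ?thesis unfolding extremal_def by blast
qed

text \<open>Multiplication can only enlarge \<open>Z\<close>, and maximality of the cardinality
  together with finiteness excludes a proper enlargement.\<close>

lemma extremal_mult:
  assumes f: "extremal j f" and p: "p \<in> forms A e" and pf: "p * f \<notin> R"
  shows "extremal j (p * f)" "Z (p * f) = Z f"
proof -
  obtain d where d: "f \<in> forms A d" using f by (auto simp: extremal_def)
  have pfd: "p * f \<in> forms A (e + d)" by (rule forms_mult[OF p d])
  have sub: "Z f \<subseteq> Z (p * f)"
    using R_mult[OF p] by (auto simp: Z_def mult.left_commute)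
  have "j \<in> Z (p * f)" using sub f by (auto simp: extremal_def)
  then have "card (Z (p * f)) \<le> card (Z f)"
    using f pf pfd by (auto simp: extremal_def)
  then show eq: "Z (p * f) = Z f"
    using card_seteq[OF Z_bound(1)[OF pfd pf] sub] by simp
  show "extremal j (p * f)"
    using f pf pfd by (auto simp: extremal_def eq)
qed

lemma extremal_prod:
  assumes f: "extremal j f" and I: "finite I" "I \<inter> Z f = {}"
  shows "extremal j ((\<Prod>i\<in>I. lam i) * f) \<and> Z ((\<Prod>i\<in>I. lam i) * f) = Z f"
  using I
proof (induction I rule: finite_induct)
  case empty
  then show ?case using f by simp
next
  case (insert i I)
  let ?g = "(\<Prod>i\<in>I. lam i) * f"
  have IH: "extremal j ?g" "Z ?g = Z f" using insert by auto
  then have "lam i * ?g \<notin> R" using insert.prems by (auto simp: Z_def)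
  from extremal_mult[OF IH(1) ev_form this] show ?case
    using insert.hyps IH(2) by (simp add: mult.assoc)
qed

lemma lam_prod_form: "finite I \<Longrightarrow> (\<Prod>i\<in>I. lam i) \<in> forms A (card I)"
proof (induction I rule: finite_induct)
  case empty
  then show ?case using forms_single[of 0 A 0 1] by simp
next
  case (insert j I)
  then show ?case using forms_mult[OF ev_form] by simp
qed

text \<open>Otherwise every \<open>lam j\<close> sends some extremal element into R. Choosing r + 1
  indices such that later ones avoid the \<open>Z\<close> of earlier elements gives r + 1 classes
  independent modulo R in one large degree, against length r.\<close>

lemma exists_nonzerodivisor:
  "\<exists>j. \<forall>d. \<forall>f\<in>forms A d. lam j * f \<in> R \<longrightarrow> f \<in> R"
proof (rule ccontr)
  assume "\<not> ?thesis"
  then have "\<forall>j. \<exists>f. extremal j f" using extremal_exists by meson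
  then obtain f where f: "\<And>j. extremal j (f j)" by metis
  then obtain deg where deg: "\<And>j. f j \<in> forms A (deg j)"
    unfolding extremal_def by metis
  have fR: "f j \<notin> R" for j using f by (auto simp: extremal_def)
  have "\<exists>b. \<forall>i\<in>Z (f j). i < b" for j
    using Z_bound(1)[OF deg fR] by (simp add: finite_nat_set_iff_bounded)
  then obtain b where b: "\<And>j i. i \<in> Z (f j) \<Longrightarrow> i < b j" by metis
  \<comment> \<open>The summand \<open>b j\<close> jumps beyond \<open>Z (f j)\<close>, and keeping
    j makes the sequence monotone, so all later indices stay outside as well.\<close>
  define J where "J i = ((\<lambda>j. j + b j) ^^ i) 0" for i
  have J_Suc: "J (Suc i) = J i + b (J i)" for i by (simp add: J_def)
  have J_mono: "J i \<le> J i'" if "i \<le> i'" for i i'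
    using that by (rule lift_Suc_mono_le[rotated]) (simp add: J_Suc)
  have J: "J i' \<notin> Z (f (J i))" if "i < i'" for i i'
    using J_mono[of "Suc i" i'] b[of "J i'" "J i"] that by (auto simp: J_Suc)
  obtain k0 where k0: "\<And>K s g. K \<ge> k0 \<Longrightarrow> (\<forall>i<s. g i \<in> forms A K) \<Longrightarrow>
     (\<forall>c. (\<Sum>i<s. smult (c i) (g i)) \<in> R \<longrightarrow> (\<forall>i<s. c i = 0)) \<Longrightarrow> s \<le> r"
    using codim_le by blast
  \<comment> \<open>Exceeds the threshold \<open>k0\<close> and every degree involved, so that
    saturation can lift all r + 1 elements to degree K.\<close>
  define K where "K = k0 + (\<Sum>i<Suc r. deg (J i))"
  have "\<exists>p\<in>forms A (K - deg (J i)). p * f (J i) \<notin> R" for i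
    by (rule R_saturated[OF deg fR])
  then obtain p where p: "\<And>i. p i \<in> forms A (K - deg (J i))" "\<And>i. p i * f (J i) \<notin> R"
    by metis
  define g where "g i = p i * f (J i)" for i
  have g_form: "g i \<in> forms A K" if "i < Suc r" for i
  proof -
    have "deg (J i) \<le> (\<Sum>i<Suc r. deg (J i))" using that by (intro member_le_sum) auto
    then have "deg (J i) \<le> K" by (simp add: K_def)
    then show ?thesis unfolding g_def using forms_mult[OF p(1)[of i] deg[of "J i"]] by simp
  qed
  have g: "extremal (J i) (g i)" "Z (g i) = Z (f (J i))" for i
    unfolding g_def using extremal_mult[OF f p] by auto
  have "Suc r \<le> r"
  proof (rule k0)
    show "K \<ge> k0" by (simp add: K_def)
    show "\<forall>i<Suc r. g i \<in> forms A K" using g_form by blast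
    show "\<forall>c. (\<Sum>i<Suc r. smult (c i) (g i)) \<in> R \<longrightarrow> (\<forall>i<Suc r. c i = 0)"
    proof (intro allI impI)
      fix c :: "nat \<Rightarrow> complex" and i
      assume sum: "(\<Sum>i<Suc r. smult (c i) (g i)) \<in> R"
      show "i < Suc r \<Longrightarrow> c i = 0"
      proof (induction i rule: less_induct)
        case (less i)
        \<comment> \<open>The product over the later indices sends each later \<open>g i'\<close>
          into R, as \<open>J i'\<close> lies in its \<open>Z\<close>, but not \<open>g i\<close>.
          Earlier coefficients vanish by induction, so only the term of i survives.\<close>
        define I where "I = J ` {i<..<Suc r}"
        let ?P = "\<Prod>i\<in>I. lam i"
        have I: "finite I" "I \<inter> Z (g i) = {}"
          using J[of i] by (auto simp: I_def g)
        have ex: "extremal (J i) (?P * g i)"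
          using extremal_prod[OF g(1) I] by blast
        have others: "?P * smult (c i') (g i') \<in> R" if "i' \<noteq> i" "i' < Suc r" for i'
        proof (cases "i' < i")
          case True
          then show ?thesis using less.IH[of i'] that cvec.subspace_0[OF R_subspace] by simp
        next
          case False
          let ?Q = "\<Prod>i\<in>I - {J i'}. lam i"
          have "J i' \<in> I" using False that by (auto simp: I_def)
          then have P: "?P = ?Q * lam (J i')"
            using prod.remove[OF I(1), of "J i'" lam] by (simp add: mult.commute)
          have "lam (J i') * g i' \<in> R"
            using g(1)[of i'] by (auto simp: extremal_def Z_def)
          then have "smult (c i') (?Q * (lam (J i') * g i')) \<in> R"
            using I(1) by (intro R_smult R_mult[OF lam_prod_form]) auto
          then show ?thesis by (simp add: P smult_mult_right mult.assoc)
        qed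
        have "?P * (\<Sum>i<Suc r. smult (c i) (g i)) - (\<Sum>i'\<in>{..<Suc r} - {i}. ?P * smult (c i') (g i')) \<in> R"
          by (intro R_diff R_mult[OF lam_prod_form[OF I(1)]] sum, rule R_sum, rule others) auto
        also have "?P * (\<Sum>i<Suc r. smult (c i) (g i)) - (\<Sum>i'\<in>{..<Suc r} - {i}. ?P * smult (c i') (g i'))
            = smult (c i) (?P * g i)"
          using sum.remove[of "{..<Suc r}" i "\<lambda>i'. ?P * smult (c i') (g i')"] less.prems
          by (simp only: sum_distrib_left finite_lessThan lessThan_iff add_diff_cancel_right' smult_mult_right)
        finally have "smult (c i) (?P * g i) \<in> R" .
        moreover have "?P * g i \<notin> R" using ex by (simp add: extremal_def)
        ultimately show ?case
          using R_smult[of "smult (c i) (?P * g i)" "inverse (c i)"]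
          by (cases "c i = 0") (simp_all del: cvec.scale_left_commute)
      qed
    qed
  qed
  then show False by simp
qed

end

section \<open>Polarization and the lower bound for the length\<close>

text \<open>For a cubic form this is the symmetric trilinear form with F on the diagonal.
  Inclusion-exclusion expresses it by values of F, for which the coordinate forms \<open>ev\<close>
  are available.\<close>

definition polar ::
    "(nat, complex) polyn \<Rightarrow> (nat \<Rightarrow> complex) \<Rightarrow> (nat \<Rightarrow> complex) \<Rightarrow> (nat \<Rightarrow> complex) \<Rightarrow> complex" where
  "polar F u v w = (eval_at (\<lambda>i. u i + v i + w i) F - eval_at (\<lambda>i. u i + v i) F
     - eval_at (\<lambda>i. u i + w i) F - eval_at (\<lambda>i. v i + w i) F
     + eval_at u F + eval_at v F + eval_at w F) / 6"

text \<open>The coordinate form that lifts the product of three linear forms.\<close>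

definition tau ::
    "nat \<Rightarrow> (nat \<Rightarrow> complex) \<Rightarrow> (nat \<Rightarrow> complex) \<Rightarrow> (nat \<Rightarrow> complex) \<Rightarrow> (nat \<Rightarrow>\<^sub>0 nat, complex) polyn" where
  "tau n u v w = smult (1 / 6) (ev n (\<lambda>i. u i + v i + w i) - ev n (\<lambda>i. u i + v i)
     - ev n (\<lambda>i. u i + w i) - ev n (\<lambda>i. v i + w i) + ev n u + ev n v + ev n w)"

lemma tau_form: "tau n u v w \<in> forms (monomials n 3) 1"
  unfolding tau_def by (intro forms_smult forms_add forms_diff ev_form)

lemma eval_at_tau: "F \<in> Sd n 3 \<Longrightarrow> eval_at (Poly_Mapping.lookup F) (tau n u v w) = polar F u v w"
  by (simp add: tau_def polar_def eval_at_ev)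

lemma eval_at_veronese_tau [simp]:
  "eval_at (Poly_Mapping.lookup (lin n x ^ 3)) (tau n u v w) = dot n x u * dot n x v * dot n x w"
  by (simp add: tau_def) (simp add: algebra_simps)

context veronese_subscheme
begin

lemma length_gt_if_concise_and_vanishing_hessian:
  assumes F: "F \<in> linear_span n 3 R"
    and concise: "\<And>a. (\<And>v w. polar F a v w = 0) \<Longrightarrow> \<forall>i\<le>n. a i = 0"
    and hess: "\<And>l. (\<forall>i\<le>n. l i \<noteq> 0) \<Longrightarrow> \<exists>a. (\<exists>i\<le>n. a i \<noteq> 0) \<and> (\<forall>b. polar F l a b = 0)"
  shows "n + 1 < r"
proof (rule ccontr)
  assume "\<not> n + 1 < r"
  then have r: "r \<le> n + 1" by simp
  obtain j where nzd: "\<And>d f. f \<in> forms A d \<Longrightarrow> lam j * f \<in> R \<Longrightarrow> f \<in> R"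
    using exists_nonzerodivisor by blast
  define l where "l = curve j"
  have FS: "F \<in> Sd n 3" using F by (simp add: linear_span_def)
  have F_R: "eval_at (Poly_Mapping.lookup F) s = 0" if "s \<in> R" "s \<in> forms A 1" for s
    using F that by (auto simp: linear_span_def)
  have form2: "p * q \<in> forms A 2" if "p \<in> forms A 1" "q \<in> forms A 1" for p q
    using forms_mult[OF that] by (simp add: numeral_2_eq_2)
  note fs = form2 ev_form tau_form forms_diff forms_add forms_smult forms_sum

  have inj: "\<forall>i\<le>n. a i = 0" if a: "tau n l l a \<in> R" for a
  proof (rule concise)
    fix v w
    \<comment> \<open>At cubes this product agrees with \<open>lam j * tau n a v w\<close>: three
      factors l combine to \<open>lam j\<close>, which is then cancelled.\<close>
    have "tau n l l a * tau n l v w \<in> R"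
      using R_mult[OF tau_form[of n l v w] a] by (simp add: mult.commute)
    then have "lam j * tau n a v w \<in> R"
      by (subst R_cong[where d = 2 and s' = "tau n l l a * tau n l v w"])
         (auto intro!: fs simp: l_def)
    then have "tau n a v w \<in> R" by (rule nzd[OF tau_form])
    from F_R[OF this tau_form] show "polar F a v w = 0" by (simp add: eval_at_tau[OF FS])
  qed

  \<comment> \<open>If t were not of this form, the classes of \<open>tau n l l\<close> at the n + 1
    unit vectors together with t would be n + 2 independent ones.\<close>
  have surj: "\<exists>b. t - tau n l l b \<in> R" if t: "t \<in> forms A 1" for t
  proof (rule ccontr)
    assume neg: "\<not> ?thesis"
    obtain k0 where k0: "\<And>K s g. K \<ge> k0 \<Longrightarrow> (\<forall>i<s. g i \<in> forms A K) \<Longrightarrow>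
       (\<forall>c. (\<Sum>i<s. smult (c i) (g i)) \<in> R \<longrightarrow> (\<forall>i<s. c i = 0)) \<Longrightarrow> s \<le> r"
      using codim_le by blast
    define \<delta> where "\<delta> a i = (if i = a then 1 else 0 :: complex)" for a i :: nat
    define g where "g i = (if i \<le> n then tau n l l (\<delta> i) else t)" for i
    have g: "g i \<in> forms A 1" for i
      unfolding g_def using t tau_form by (auto simp del: One_nat_def)
    have nzd_pow: "f \<in> R" if "f \<in> forms A d" "lam j ^ e * f \<in> R" for f d e
      using that
    proof (induction e)
      case (Suc e)
      have "lam j ^ e * f \<in> R"
        by (rule nzd[OF forms_mult[OF forms_power[OF ev_form] Suc.prems(1)]])
           (use Suc.prems in \<open>simp add: mult.assoc\<close>)
      then show ?case using Suc by blast
    qed simp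
    have ind: "\<forall>i<n+2. c i = 0" if c: "(\<Sum>i<n+2. smult (c i) (g i)) \<in> R" for c
    proof -
      have "(\<Sum>i<n+2. smult (c i) (g i)) = (\<Sum>i\<le>n. smult (c i) (g i)) + smult (c (n+1)) (g (n+1))"
        by (simp add: lessThan_Suc_atMost)
      then have sum: "(\<Sum>i\<le>n. smult (c i) (tau n l l (\<delta> i))) + smult (c (n+1)) t \<in> R"
        using c by (simp add: g_def)
      have dot: "(\<Sum>i\<le>n. c i * dot n x (\<delta> i)) = dot n x c" for x
        by (simp add: dot_def \<delta>_def if_distrib mult.commute cong: if_cong)
      have phi: "(\<Sum>i\<le>n. c i * (dot n x l * dot n x l * dot n x (\<delta> i)))
          = dot n x l * dot n x l * dot n x c" for x
        by (simp add: dot[symmetric] sum_distrib_left mult.left_commute)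
      have sum': "tau n l l c + smult (c (n+1)) t \<in> R"
      proof (rule R_cong[where d = 1, THEN iffD2, OF _ _ _ sum])
        show "eval_at (Poly_Mapping.lookup (lin n x ^ 3)) (tau n l l c + smult (c (n+1)) t)
          = eval_at (Poly_Mapping.lookup (lin n x ^ 3))
              ((\<Sum>i\<le>n. smult (c i) (tau n l l (\<delta> i))) + smult (c (n+1)) t)" for x
          by (simp add: phi)
      qed (intro fs t)+
      have "c (n+1) = 0"
      proof (rule ccontr)
        assume nz: "c (n+1) \<noteq> 0"
        \<comment> \<open>Solves the relation for t: multiplied by \<open>- d\<close> it has
          coefficient 1 at t.\<close>
        define d where "d = - inverse (c (n+1))"
        have d: "d * c (n+1) = - 1" using nz by (simp add: d_def)
        have "t - tau n l l (\<lambda>i. d * c i) \<in> R"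
        proof (rule R_cong[where d = 1, THEN iffD2, OF _ _ _ R_smult[OF sum', of "- d"]])
          show "eval_at (Poly_Mapping.lookup (lin n x ^ 3)) (t - tau n l l (\<lambda>i. d * c i))
            = eval_at (Poly_Mapping.lookup (lin n x ^ 3)) (smult (- d) (tau n l l c + smult (c (n+1)) t))" for x
          proof -
            let ?t = "eval_at (Poly_Mapping.lookup (lin n x ^ 3)) t"
            have "- d * (c (n+1) * ?t) = ?t"
              using d by (metis minus_mult_left mult.assoc mult_minus1 minus_minus)
            then show ?thesis by (simp add: dot_scale distrib_left mult.left_commute del: power_Suc)
          qed
        qed (intro fs t)+
        then show False using neg by blast
      qed
      then have "tau n l l c \<in> R" using sum' by simp
      from inj[OF this] \<open>c (n+1) = 0\<close> show ?thesis
        by (auto simp: less_Suc_eq_le le_Suc_eq)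
    qed
    \<comment> \<open>Multiplication by \<open>lam j ^ k0\<close> is injective modulo R and moves
      the n + 2 classes from degree 1 to degree \<open>k0 + 1\<close>, where r bounds the number of
      independent classes.\<close>
    have "n + 2 \<le> r"
    proof (rule k0)
      show "k0 + 1 \<ge> k0" by simp
      show "\<forall>i<n+2. lam j ^ k0 * g i \<in> forms A (k0 + 1)"
        using forms_mult[OF forms_power[OF ev_form, where k = k0] g] by simp
      show "\<forall>c. (\<Sum>i<n+2. smult (c i) (lam j ^ k0 * g i)) \<in> R \<longrightarrow> (\<forall>i<n+2. c i = 0)"
      proof (intro allI impI)
        fix c i
        assume "(\<Sum>i<n+2. smult (c i) (lam j ^ k0 * g i)) \<in> R" and i: "i < n + 2"
        then have "lam j ^ k0 * (\<Sum>i<n+2. smult (c i) (g i)) \<in> R"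
          by (simp only: sum_distrib_left smult_mult_right)
        then have "(\<Sum>i<n+2. smult (c i) (g i)) \<in> R"
          by (rule nzd_pow[OF forms_sum[OF forms_smult[OF g]]])
        from ind[OF this] i show "c i = 0" by blast
      qed
    qed
    then show False using r by simp
  qed

  have "\<forall>i\<le>n. l i \<noteq> 0" by (simp add: l_def curve_nonzero)
  then obtain a where a: "\<exists>i\<le>n. a i \<noteq> 0" and ker: "\<And>b. polar F l a b = 0"
    using hess by blast
  have "\<forall>i\<le>n. a i = 0"
  proof (rule concise)
    fix v w
    obtain b where b: "tau n v w l - tau n l l b \<in> R" using surj[OF tau_form] by blast
    \<comment> \<open>Modulo R this is \<open>lam j\<close> times
      \<open>tau n a v w - tau n l a b\<close>; after cancelling, F vanishes on the second term
      because a lies in the kernel of the Hessian at l.\<close>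
    have "tau n l l a * (tau n v w l - tau n l l b) \<in> R"
      by (rule R_mult[OF tau_form b])
    then have "lam j * (tau n a v w - tau n l a b) \<in> R"
      by (subst R_cong[where d = 2 and s' = "tau n l l a * (tau n v w l - tau n l l b)"])
         (auto intro!: fs simp: l_def algebra_simps)
    then have "tau n a v w - tau n l a b \<in> R"
      by (rule nzd[OF forms_diff[OF tau_form tau_form]])
    from F_R[OF this forms_diff[OF tau_form tau_form]] show "polar F a v w = 0"
      by (simp add: eval_at_tau[OF FS] ker)
  qed
  then show False using a by blast
qed

end

section \<open>The cubic\<close>

text \<open>Squares are written as products to fit \<open>polar_monomial\<close>; the second sum
  starts at 0 to avoid subtraction in indices.\<close>

definition cubic :: "nat \<Rightarrow> (nat, complex) polyn" where
  "cubic k = (\<Sum>i\<le>k. Var (3 * i) * Var (3 * i + 1) * Var (3 * i + 1))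
     + (\<Sum>i<k. Var (3 * i + 1) * Var (3 * i + 2) * Var (3 * i + 4))"

lemma cubic_form: "cubic k \<in> Sd (3 * k + 1) 3"
proof -
  have "Var a * Var b * Var c \<in> Sd n 3" if "a \<le> n" "b \<le> n" "c \<le> n" for a b c n
    using forms_mult[OF forms_mult[OF forms_Var forms_Var] forms_Var, of a "{..n}" b c] that
    by (simp add: numeral_3_eq_3)
  then show ?thesis
    unfolding cubic_def by (intro forms_add forms_sum) auto
qed

lemma polar_add: "polar (p + q) u v w = polar p u v w + polar q u v w"
  by (simp add: polar_def add_divide_distrib diff_divide_distrib)

lemma polar_sum: "polar (sum f I) u v w = (\<Sum>i\<in>I. polar (f i) u v w)"
  by (induction I rule: infinite_finite_induct) (simp_all add: polar_add, simp_all add: polar_def)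

lemma polar_monomial:
  "polar (Var p * Var q * Var s) u v w =
    (u p * (v q * w s + w q * v s) + v p * (u q * w s + w q * u s) + w p * (u q * v s + v q * u s)) / 6"
  by (simp add: polar_def algebra_simps)

definition unit_vec :: "nat \<Rightarrow> nat \<Rightarrow> complex" where
  "unit_vec p i = (if i = p then 1 else 0)"

lemma mod_3_simps:
  fixes i p :: nat
  shows "(3 * i = 3 * p) = (i = p)" "(3 * i = 3 * p + 1) = False" "(3 * i = 3 * p + 4) = False"
    "(3 * i + 1 = 3 * p) = False" "(3 * i + 1 = 3 * p + 1) = (i = p)" "(3 * i + 1 = 3 * p + 4) = (i = p + 1)"
    "(3 * i + 2 = 3 * p) = False" "(3 * i + 2 = 3 * p + 1) = False" "(3 * i + 2 = 3 * p + 4) = False"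
    "(3 * i + 4 = 3 * p) = False" "(3 * i + 4 = 3 * p + 1) = (i + 1 = p)" "(3 * i + 4 = 3 * p + 4) = (i = p)"
  by presburger+

text \<open>Each variable is, up to a factor, a second partial derivative of the cubic: number
  \<open>3 * p\<close> in the directions \<open>3 * p + 1\<close> twice, number
  \<open>3 * p + 1\<close> in the directions \<open>3 * p\<close> and \<open>3 * p + 1\<close>, and
  number \<open>3 * p + 2\<close> in the directions \<open>3 * p + 1\<close> and
  \<open>3 * p + 4\<close>.\<close>

lemma cubic_concise:
  assumes polar: "\<And>v w. polar (cubic k) a v w = 0"
  shows "\<forall>i\<le>3 * k + 1. a i = 0"
proof -
  have u: "a (3 * p) = 0" if "p \<le> k" for p
  proof -
    have "polar (cubic k) a (unit_vec (3 * p + 1)) (unit_vec (3 * p + 1))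
        = (\<Sum>i\<le>k. if i = p then a (3 * i) / 3 else 0) + (\<Sum>i<k. 0)"
      unfolding cubic_def polar_add polar_sum polar_monomial unit_vec_def mod_3_simps
      by (intro arg_cong2[where f = "(+)"] sum.cong) auto
    then show ?thesis using polar that by simp
  qed
  have y: "a (3 * p + 1) = 0" if "p \<le> k" for p
  proof -
    have "polar (cubic k) a (unit_vec (3 * p)) (unit_vec (3 * p + 1))
        = (\<Sum>i\<le>k. if i = p then a (3 * i + 1) / 3 else 0) + (\<Sum>i<k. 0)"
      unfolding cubic_def polar_add polar_sum polar_monomial unit_vec_def mod_3_simps
      by (intro arg_cong2[where f = "(+)"] sum.cong) auto
    then show ?thesis using polar that by simp
  qed
  have w: "a (3 * p + 2) = 0" if "p < k" for p
  proof -
    have "polar (cubic k) a (unit_vec (3 * p + 1)) (unit_vec (3 * p + 4))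
        = (\<Sum>i\<le>k. 0) + (\<Sum>i<k. if i = p then a (3 * i + 2) / 6 else 0)"
      unfolding cubic_def polar_add polar_sum polar_monomial unit_vec_def mod_3_simps
      by (intro arg_cong2[where f = "(+)"] sum.cong) auto
    then show ?thesis using polar that by simp
  qed
  show ?thesis
  proof (intro allI impI)
    fix i assume i: "i \<le> 3 * k + 1"
    have "i = 3 * (i div 3) \<or> i = 3 * (i div 3) + 1 \<or> i = 3 * (i div 3) + 2" by presburger
    moreover have "i = 3 * (i div 3) + 2 \<Longrightarrow> i div 3 < k" "i div 3 \<le> k" using i by presburger+
    ultimately show "a i = 0" using u y w by metis
  qed
qed

text \<open>
  The second partial derivatives in the directions 0, 2, 3 only involve the variables 1 and 4, and
  the first partial derivatives \<open>x\<^sub>1\<^sup>2, x\<^sub>1 x\<^sub>4, x\<^sub>4\<^sup>2\<close> are algebraically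
  dependent; differentiating \<open>x\<^sub>1\<^sup>2 x\<^sub>4\<^sup>2 = (x\<^sub>1 x\<^sub>4)\<^sup>2\<close> gives the kernel vector.
\<close>

lemma cubic_vanishing_hessian:
  assumes k: "k \<ge> 1" and l: "\<forall>i\<le>3 * k + 1. l i \<noteq> 0"
  shows "\<exists>a. (\<exists>i\<le>3 * k + 1. a i \<noteq> 0) \<and> (\<forall>b. polar (cubic k) l a b = 0)"
proof -
  define a where "a i = (if i = 0 then l 4 ^ 2 else 0) + (if i = 3 then l 1 ^ 2 else 0)
    + (if i = 2 then - 2 * l 1 * l 4 else 0)" for i :: nat
  have a: "a (3 * i) = (if i = 0 then l 4 ^ 2 else 0) + (if i = 1 then l 1 ^ 2 else 0)"
    "a (3 * i + 1) = 0" "a (3 * i + 2) = (if i = 0 then - 2 * l 1 * l 4 else 0)" "a (3 * i + 4) = 0" for i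
  proof -
    have "(3 * i = 3) = (i = 1)" "(3 * i = 2) = False" "(3 * i + 1 = 0) = False" "(3 * i + 1 = 3) = False"
      "(3 * i + 1 = 2) = False" "(3 * i + 2 = 0) = False" "(3 * i + 2 = 3) = False"
      "(3 * i + 2 = 2) = (i = 0)" "(3 * i + 4 = 0) = False" "(3 * i + 4 = 3) = False"
      "(3 * i + 4 = 2) = False" "(3 * i = 0) = (i = 0)"
      by presburger+
    note * = this
    show "a (3 * i) = (if i = 0 then l 4 ^ 2 else 0) + (if i = 1 then l 1 ^ 2 else 0)"
      "a (3 * i + 1) = 0" "a (3 * i + 2) = (if i = 0 then - 2 * l 1 * l 4 else 0)" "a (3 * i + 4) = 0"
      unfolding a_def * by simp_all
  qed
  have "polar (cubic k) l a b = 0" for b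
  proof -
    have "polar (cubic k) l a b
      = (\<Sum>i\<le>k. (if i = 0 then l 4 ^ 2 * l 1 * b 1 / 3 else 0) + (if i = 1 then l 1 ^ 2 * l 4 * b 4 / 3 else 0))
        + (\<Sum>i<k. if i = 0 then - l 1 * l 4 * (l 1 * b 4 + b 1 * l 4) / 3 else 0)"
      unfolding cubic_def polar_add polar_sum polar_monomial a
      by (intro arg_cong2[where f = "(+)"] sum.cong) (auto simp: field_simps)
    also have "\<dots> = 0"
      using k by (simp add: sum.distrib) (simp add: field_simps power2_eq_square)
    finally show ?thesis .
  qed
  moreover have "a 3 \<noteq> 0" using l k by (simp add: a_def)
  moreover have "3 \<le> 3 * k + 1" using k by simp
  ultimately show ?thesis by blast
qed

section \<open>Border rank\<close>

text \<open>An equation of the secant variety vanishes along the curve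
  \<open>F + t Q + t^2 C\<close> for nonzero t, hence by continuity at t = 0.\<close>

lemma secant_variety_limit:
  assumes F: "F \<in> Sd n d"
    and span: "\<And>t. t \<noteq> 0 \<Longrightarrow> \<exists>B. finite B \<and> B \<noteq> {} \<and> card B \<le> r \<and> B \<subseteq> veronese n d \<and>
       F + smult t Q + smult (t ^ 2) C \<in> cvec.span B"
  shows "F \<in> secant_variety r n d"
proof -
  let ?U = "Poly_Mapping.lookup ` (\<Union>P\<in>{P. \<forall>a<r. P a \<in> veronese n d}. cvec.span (P ` {..<r}))"
  have U: "Poly_Mapping.lookup (F + smult t Q + smult (t ^ 2) C) \<in> ?U" if t: "t \<noteq> 0" for t
  proof -
    obtain B where B: "finite B" "B \<noteq> {}" "card B \<le> r" "B \<subseteq> veronese n d"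
      "F + smult t Q + smult (t ^ 2) C \<in> cvec.span B"
      using span[OF t] by blast
    obtain h where h: "bij_betw h {0..<card B} B"
      using ex_bij_betw_nat_finite[OF B(1)] by blast
    obtain b where b: "b \<in> B" using B(2) by blast
    \<comment> \<open>Indices from \<open>card B\<close> on repeat one element b, which turns the
      set into a family of r points with the same span.\<close>
    define P where "P a = (if a < card B then h a else b)" for a
    have "B \<subseteq> P ` {..<r}"
    proof
      fix x assume "x \<in> B"
      then obtain a where "a < card B" "x = h a"
        using h unfolding bij_betw_def by (metis atLeastLessThan_iff imageE)
      then show "x \<in> P ` {..<r}" using B(3) by (auto simp: P_def intro!: image_eqI[of _ _ a])
    qed
    moreover have "P a \<in> B" for a
      using h b by (auto simp: P_def bij_betw_def)
    ultimately have "P ` {..<r} = B" "\<forall>a<r. P a \<in> veronese n d" using B(4) by auto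
    then show ?thesis using B(5) by blast
  qed
  have "eval_at (Poly_Mapping.lookup F) p = 0" if p: "p \<in> proj_ideal (monomials n d) ?U" for p
  proof -
    define \<phi> where "\<phi> t = eval_at (Poly_Mapping.lookup (F + smult t Q + smult (t ^ 2) C)) p" for t
    have "continuous_on UNIV \<phi>"
      unfolding \<phi>_def eval_at_def by (simp add: lookup_add) (intro continuous_intros)
    then have "(\<phi> \<longlongrightarrow> \<phi> 0) (at 0)"
      by (simp add: continuous_on_def)
    moreover have "(\<phi> \<longlongrightarrow> 0) (at 0)"
    proof (rule tendsto_eventually)
      show "\<forall>\<^sub>F t in at 0. \<phi> t = 0"
        using proj_ideal_eval[OF p U] by (auto simp: \<phi>_def eventually_at_filter)
    qed
    ultimately have "\<phi> 0 = 0" by (intro tendsto_unique[of "at 0" \<phi>]) auto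
    then show ?thesis by (simp add: \<phi>_def)
  qed
  then show ?thesis
    using F by (simp add: secant_variety_def zariski_closure_def)
qed

text \<open>
  With y, z consecutive variables of the chain, the cubes of \<open>y - z, y + 2 z, 2 y + z\<close> and
  y, z are linearly dependent, while the squares of the former span all quadrics in y and z.
\<close>

lemma block_identity:
  fixes y z w u T :: "'a::comm_ring_1"
  shows "- (2 * (y - z + T * (5 * w - 4 * u)) ^ 3) + (y + 2 * z + T * (8 * u + 2 * w)) ^ 3
      - (2 * y + z + T * (4 * u - 2 * w)) ^ 3
    = 9 * z ^ 3 - 9 * y ^ 3 + 108 * T * (u * z * z + y * w * z)
      + T ^ 2 * (3 * (- (2 * (y - z) * (5 * w - 4 * u) ^ 2) + (y + 2 * z) * (8 * u + 2 * w) ^ 2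
                - (2 * y + z) * (4 * u - 2 * w) ^ 2))
      + T ^ 3 * (- (2 * (5 * w - 4 * u) ^ 3) + (8 * u + 2 * w) ^ 3 - (4 * u - 2 * w) ^ 3)"
  by (simp add: power2_eq_square power3_eq_cube algebra_simps)

lemma numeral_mult_eq_smult: "numeral c * p = smult (numeral c) p"
  by (simp add: smult_def)

lemma single_0_power: "Poly_Mapping.single (0 :: 'a::monoid_add) (c :: 'c::comm_semiring_1) ^ e = Poly_Mapping.single 0 (c ^ e)"
  by (induction e) (simp_all add: mult_single)

lemma cubic_secant: "cubic k \<in> secant_variety (3 * k + 2) (3 * k + 1) 3"
proof -
  let ?n = "3 * k + 1"
  define y where "y i = (Var (3 * i + 1) :: (nat, complex) polyn)" for i
  define u where "u i = (Var (3 * i) :: (nat, complex) polyn)" for i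
  define w where "w i = (Var (3 * i + 2) :: (nat, complex) polyn)" for i
  \<comment> \<open>With y, z for consecutive \<open>y i\<close>, the coefficients of w and u are
    those that write multiples of y z and z^2 as combinations of the squares of the three
    unperturbed forms.\<close>
  define m1 where "m1 T i = y i - y (Suc i) + T * (5 * w i - 4 * u (Suc i))" for T i
  define m2 where "m2 T i = y i + 2 * y (Suc i) + T * (8 * u (Suc i) + 2 * w i)" for T i
  define m3 where "m3 T i = 2 * y i + y (Suc i) + T * (4 * u (Suc i) - 2 * w i)" for T i
  \<comment> \<open>No block produces \<open>y 0 * y 0 * u 0\<close>, so the end of the chain is
    perturbed too: in \<open>9 * m0 T ^ 3\<close> this term has coefficient 9 * 3 * 4 = 108 at first
    order.\<close>
  define m0 where "m0 T = y 0 + T * (4 * u 0)" for T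
  define Q where "Q = 432 * (y 0 * u 0 ^ 2) +
    (\<Sum>i<k. 3 * (- (2 * (y i - y (Suc i)) * (5 * w i - 4 * u (Suc i)) ^ 2)
        + (y i + 2 * y (Suc i)) * (8 * u (Suc i) + 2 * w i) ^ 2
        - (2 * y i + y (Suc i)) * (4 * u (Suc i) - 2 * w i) ^ 2))"
  define C where "C = 576 * u 0 ^ 3 +
    (\<Sum>i<k. - (2 * (5 * w i - 4 * u (Suc i)) ^ 3) + (8 * u (Suc i) + 2 * w i) ^ 3
        - (4 * u (Suc i) - 2 * w i) ^ 3)"
  have cubic: "cubic k = y 0 * y 0 * u 0 + (\<Sum>i<k. u (Suc i) * y (Suc i) * y (Suc i) + y i * w i * y (Suc i))"
    unfolding cubic_def y_def u_def w_def
    by (simp add: sum.atMost_shift sum.distrib algebra_simps)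
  \<comment> \<open>Order zero in T telescopes to 0, order one is 108 times the cubic, and Q and C
    collect the rest. T is an arbitrary polynomial here, so the identity lives in one commutative
    ring.\<close>
  have total: "9 * m0 T ^ 3 - 9 * y k ^ 3 + (\<Sum>i<k. - (2 * m1 T i ^ 3) + m2 T i ^ 3 - m3 T i ^ 3)
      = 108 * T * cubic k + T ^ 2 * Q + T ^ 3 * C" for T
  proof -
    have "(\<Sum>i<k. 9 * y (Suc i) ^ 3 - 9 * y i ^ 3) = 9 * y k ^ 3 - 9 * y 0 ^ 3"
      by (rule sum_lessThan_telescope)
    moreover have "9 * m0 T ^ 3 = 9 * y 0 ^ 3 + 108 * T * (y 0 * y 0 * u 0) + T ^ 2 * (432 * (y 0 * u 0 ^ 2))
        + T ^ 3 * (576 * u 0 ^ 3)"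
      by (simp add: m0_def power2_eq_square power3_eq_cube algebra_simps)
    ultimately show ?thesis
      unfolding m1_def m2_def m3_def block_identity cubic Q_def C_def sum.distrib
      by (simp only: distrib_left sum_distrib_left) (simp add: sum.distrib algebra_simps)
  qed
  show ?thesis
  proof (rule secant_variety_limit[OF cubic_form])
    fix t :: complex
    assume t: "t \<noteq> 0"
    define T where "T = (Poly_Mapping.single 0 t :: (nat, complex) polyn)"
    \<comment> \<open>Two cubes for the ends of the chain and three for each block, at most
      \<open>3 * k + 2\<close> in all.\<close>
    define B where "B = {m0 T ^ 3, y k ^ 3} \<union> (\<Union>i<k. {m1 T i ^ 3, m2 T i ^ 3, m3 T i ^ 3})"
    have T: "T * p = smult t p" "T ^ e = Poly_Mapping.single 0 (t ^ e)" for p e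
      by (simp_all add: T_def smult_def single_0_power)
    have card: "card B \<le> 3 * k + 2"
    proof -
      have "card (\<Union>i<k. {m1 T i ^ 3, m2 T i ^ 3, m3 T i ^ 3})
          \<le> (\<Sum>i<k. card {m1 T i ^ 3, m2 T i ^ 3, m3 T i ^ 3})"
        by (rule card_UN_le) simp
      also have "\<dots> \<le> (\<Sum>i<k. 3)"
        by (rule sum_mono) (simp add: card_insert_if)
      finally have "card (\<Union>i<k. {m1 T i ^ 3, m2 T i ^ 3, m3 T i ^ 3}) \<le> 3 * k" by simp
      moreover have "card {m0 T ^ 3, y k ^ 3} \<le> 2" by (simp add: card_insert_if)
      ultimately show ?thesis
        unfolding B_def
        using card_Un_le[of "{m0 T ^ 3, y k ^ 3}" "\<Union>i<k. {m1 T i ^ 3, m2 T i ^ 3, m3 T i ^ 3}"]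
        by linarith
    qed
    \<comment> \<open>Nonvanishing is tested by evaluation, below at the unit vector of the first y
      in the form, where the perturbation vanishes.\<close>
    have vero: "L ^ 3 \<in> veronese ?n 3" if "L \<in> Sd ?n 1" "eval_at v L \<noteq> 0" for L v
    proof -
      have "L \<noteq> 0" using that(2) by auto
      then show ?thesis using that(1) by (auto simp: veronese_def)
    qed
    have forms: "y i \<in> Sd ?n 1" "u i \<in> Sd ?n 1" if "i \<le> k" for i
      unfolding y_def u_def using that by (rule_tac forms_Var, simp)+
    have formw: "w i \<in> Sd ?n 1" if "i < k" for i
      unfolding w_def using that by (intro forms_Var) auto
    note fs = forms_add forms_diff forms_smult forms formw
    have sub: "B \<subseteq> veronese ?n 3"
    proof -
      have "m0 T ^ 3 \<in> veronese ?n 3"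
        by (rule vero[of _ "unit_vec 1"])
           (simp_all only: m0_def T numeral_mult_eq_smult, intro fs, simp_all add: y_def u_def unit_vec_def)
      moreover have "y k ^ 3 \<in> veronese ?n 3"
        by (rule vero[of _ "unit_vec (3 * k + 1)"], intro fs, simp_all add: y_def unit_vec_def)
      moreover have "m1 T i ^ 3 \<in> veronese ?n 3" if "i < k" for i
        by (rule vero[of _ "unit_vec (3 * i + 1)"])
           (simp_all only: m1_def T numeral_mult_eq_smult, intro fs, use that in \<open>simp_all add: y_def u_def w_def unit_vec_def\<close>)
      moreover have "m2 T i ^ 3 \<in> veronese ?n 3" if "i < k" for i
        by (rule vero[of _ "unit_vec (3 * i + 1)"])
           (simp_all only: m2_def T numeral_mult_eq_smult, intro fs, use that in \<open>simp_all add: y_def u_def w_def unit_vec_def\<close>)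
      moreover have "m3 T i ^ 3 \<in> veronese ?n 3" if "i < k" for i
        by (rule vero[of _ "unit_vec (3 * i + 1)"])
           (simp_all only: m3_def T numeral_mult_eq_smult, intro fs, use that in \<open>simp_all add: y_def u_def w_def unit_vec_def\<close>)
      ultimately show ?thesis by (auto simp: B_def)
    qed
    have "9 * m0 T ^ 3 - 9 * y k ^ 3 + (\<Sum>i<k. - (2 * m1 T i ^ 3) + m2 T i ^ 3 - m3 T i ^ 3) \<in> cvec.span B"
      unfolding numeral_mult_eq_smult B_def
      by (intro cvec.span_add cvec.span_diff cvec.span_neg cvec.span_sum cvec.span_scale cvec.span_base) auto
    \<comment> \<open>Division by \<open>108 * t\<close> leaves the cubic plus terms of order t and
      t^2, the shape of \<open>secant_variety_limit\<close>.\<close>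
    then have "smult (1 / (108 * t)) (108 * T * cubic k + T ^ 2 * Q + T ^ 3 * C) \<in> cvec.span B"
      unfolding total by (rule cvec.span_scale)
    also have "smult (1 / (108 * t)) (108 * T * cubic k + T ^ 2 * Q + T ^ 3 * C)
        = cubic k + smult t (smult (1 / 108) Q) + smult (t ^ 2) (smult (1 / 108) C)"
    proof -
      have "108 * T * cubic k + T ^ 2 * Q + T ^ 3 * C
          = smult (108 * t) (cubic k) + smult (t ^ 2) Q + smult (t ^ 3) C"
        by (simp only: mult.assoc T smult_def[symmetric])
           (simp only: numeral_mult_eq_smult cvec.scale_scale)
      then show ?thesis
        using t by (simp add: cvec.scale_right_distrib power2_eq_square power3_eq_cube)
    qed
    finally show "\<exists>B. finite B \<and> B \<noteq> {} \<and> card B \<le> 3 * k + 2 \<and> B \<subseteq> veronese ?n 3 \<and>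
        cubic k + smult t (smult (1 / 108) Q) + smult (t ^ 2) (smult (1 / 108) C) \<in> cvec.span B"
      using card sub by (intro exI[of _ B]) (auto simp: B_def)
  qed
qed

section \<open>Comparison of border rank and smoothable rank\<close>

theorem corollary7p7:
  fixes k n :: nat
  assumes "k \<ge> 1" and "n = 3 * k + 1"
  shows "wild n 3
    ((\<Sum>i=0..k. Var (3 * i) * Var (3 * i + 1) ^ 2) +
     (\<Sum>i=1..k. Var (3 * i - 2) * Var (3 * i - 1) * Var (3 * i + 1)))"
proof -
  have "(\<Sum>i=1..k. Var (3 * i - 2) * Var (3 * i - 1) * Var (3 * i + 1) :: (nat, complex) polyn)
      = (\<Sum>i<k. Var (3 * i + 1) * Var (3 * i + 2) * Var (3 * i + 4))"
  proof -
    have "3 * Suc i - 2 = 3 * i + 1" "3 * Suc i - 1 = 3 * i + 2" "3 * Suc i + 1 = 3 * i + 4" for i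
      by simp_all
    then show ?thesis unfolding One_nat_def sum.atLeast1_atMost_eq by presburger
  qed
  then have eq: "(\<Sum>i=0..k. Var (3 * i) * Var (3 * i + 1) ^ 2) +
     (\<Sum>i=1..k. Var (3 * i - 2) * Var (3 * i - 1) * Var (3 * i + 1)) = cubic k"
    by (simp add: cubic_def power2_eq_square mult.assoc atLeast0AtMost)
  \<comment> \<open>At the all-ones point every summand is 1, so the value counts the k + 1 and k
    summands.\<close>
  have "eval_at (\<lambda>_. 1) (cubic k) = of_nat (Suc k + k)"
    by (simp add: cubic_def)
  then have "eval_at (\<lambda>_. 1) (cubic k) \<noteq> 0"
    by (simp only: of_nat_eq_0_iff)
  then have nz: "cubic k \<noteq> 0" by auto
  have "border_rank n 3 (cubic k) \<le> enat (n + 1)"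
    unfolding border_rank_def using cubic_secant[of k] assms(2) by (intro INF_lower) simp
  also have "enat (n + 1) < enat (n + 2)" by simp
  also have "enat (n + 2) \<le> smoothable_rank n 3 (cubic k)"
    unfolding smoothable_rank_def
  proof (rule INF_greatest, clarify)
    fix r R
    assume R: "zero_dim_scheme (monomials n 3) r R" "veronese_ideal n 3 \<subseteq> R"
      and F: "cubic k \<in> linear_span n 3 R"
    interpret veronese_subscheme n r R
      by unfold_locales (rule R)+
    have "n + 1 < r"
    proof (rule length_gt_if_concise_and_vanishing_hessian[OF F])
      fix a assume "\<And>v w. polar (cubic k) a v w = 0"
      then show "\<forall>i\<le>n. a i = 0"
        unfolding assms(2) by (rule cubic_concise)
    next
      fix l :: "nat \<Rightarrow> complex" assume "\<forall>i\<le>n. l i \<noteq> 0"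
      then show "\<exists>a. (\<exists>i\<le>n. a i \<noteq> 0) \<and> (\<forall>b. polar (cubic k) l a b = 0)"
        unfolding assms(2) by (rule cubic_vanishing_hessian[OF assms(1)])
    qed
    then show "enat (n + 2) \<le> enat r" by simp
  qed
  finally have "border_rank n 3 (cubic k) < smoothable_rank n 3 (cubic k)" .
  then show ?thesis
    unfolding eq wild_def using cubic_form[of k] nz assms(2) by simp
qed

end
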